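(* Let $G=(V,E)$ be a connected graph without multiedges or self-loops. Then $G$ has a flexible assignment on the sphere if and only if $G$ admits a NAP-coloring.
   Context: Let $S^2_{\mathbb{C}}=\{(x,y,z)\in\mathbb{C}^3 : x^2+y^2+z^2=1\}$. For $T,U\in S^2_{\mathbb{C}}$ put $\langle T,U\rangle=\sum_{i=1}^3 T_iU_i$ and define the spherical distance $d_{S^2}(T,U)=\frac{1-\langle T,U\rangle}{2}$. A realization of $G$ is a map $\rho\colon V\to S^2_{\mathbb{C}}$. Given an assignment $\lambda\colon E\to\mathbb{C}\setminus\{0,1\}$, a realization $\rho$ is compatible with $\lambda$ if $d_{S^2}(\rho(a),\rho(b))=\lambda(\{a,b\})$ for all $\{a,b\}\in E$ (non-adjacent vertices may coincide or be antipodal). Two realizations $\rho_1,\rho_2$ are essentially distinct if there is no $\sigma\in\mathrm{SO}_3(\mathbb{C})=\{\sigma\in\mathbb{C}^{3\times3}:\sigma\sigma^t=\sigma^t\sigma=\mathrm{id},\ \det\sigma=1\}$ with $\rho_1=\sigma\circ\rho_2$. The assignment $\lambda$ is a flexible assignment (on the sphere) if there are infinitely many pairwise essentially distinct realizations compatible with $\lambda$. A coloring $\varepsilon\colon E\to\{\text{red},\text{blue}\}$ is a NAP-coloring if it is surjective and there is no alternating path, where a path $(v,w,z,t)$ in $G$ (with edges $\{v,w\},\{w,z\},\{z,t\}$) is alternating if $\{v,w\}$ and $\{z,t\}$ have the same color and $\{w,z\}$ has the other color. *)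

theory Defs
  imports "HOL-Analysis.Analysis"
begin

definition simple_graph :: "'v set \<Rightarrow> 'v set set \<Rightarrow> bool" where
  "simple_graph V E \<longleftrightarrow>
     finite V \<and> (\<forall>e\<in>E. \<exists>a\<in>V. \<exists>b\<in>V. a \<noteq> b \<and> e = {a, b})"

definition connected_graph :: "'v set \<Rightarrow> 'v set set \<Rightarrow> bool" where
  "connected_graph V E \<longleftrightarrow>
     (\<forall>a\<in>V. \<forall>b\<in>V. (a, b) \<in> {(u, v). {u, v} \<in> E}\<^sup>*)"

text \<open>The bilinear (not Hermitian) form, which is different from the library's inner product.\<close>

definition bilin :: "complex ^ 3 \<Rightarrow> complex ^ 3 \<Rightarrow> complex" where
  "bilin T U = (\<Sum>i\<in>UNIV. T $ i * U $ i)"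

definition sphere2C :: "(complex ^ 3) set" where
  "sphere2C = {T. (T $ 1)\<^sup>2 + (T $ 2)\<^sup>2 + (T $ 3)\<^sup>2 = 1}"

definition sph_dist :: "complex ^ 3 \<Rightarrow> complex ^ 3 \<Rightarrow> complex" where
  "sph_dist T U = (1 - bilin T U) / 2"

definition SO3C :: "(complex ^ 3 ^ 3) set" where
  "SO3C = {\<sigma>. \<sigma> ** transpose \<sigma> = mat 1 \<and> transpose \<sigma> ** \<sigma> = mat 1 \<and> det \<sigma> = 1}"

text \<open>Maps defined on the vertices or on the edges are total functions of which only the values
  on \<open>V\<close> or \<open>E\<close> are ever inspected.\<close>

definition realization :: "'v set \<Rightarrow> ('v \<Rightarrow> complex ^ 3) \<Rightarrow> bool" where
  "realization V \<rho> \<longleftrightarrow> (\<forall>v\<in>V. \<rho> v \<in> sphere2C)"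

definition assignment :: "'v set set \<Rightarrow> ('v set \<Rightarrow> complex) \<Rightarrow> bool" where
  "assignment E lam \<longleftrightarrow> (\<forall>e\<in>E. lam e \<notin> {0, 1})"

definition compatible :: "'v set set \<Rightarrow> ('v set \<Rightarrow> complex) \<Rightarrow> ('v \<Rightarrow> complex ^ 3) \<Rightarrow> bool" where
  "compatible E lam \<rho> \<longleftrightarrow> (\<forall>a b. {a, b} \<in> E \<longrightarrow> sph_dist (\<rho> a) (\<rho> b) = lam {a, b})"

definition essentially_distinct ::
  "'v set \<Rightarrow> ('v \<Rightarrow> complex ^ 3) \<Rightarrow> ('v \<Rightarrow> complex ^ 3) \<Rightarrow> bool" where
  "essentially_distinct V \<rho>\<^sub>1 \<rho>\<^sub>2 \<longleftrightarrow> \<not> (\<exists>\<sigma>\<in>SO3C. \<forall>v\<in>V. \<rho>\<^sub>1 v = \<sigma> *v \<rho>\<^sub>2 v)"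

definition flexible_assignment ::
  "'v set \<Rightarrow> 'v set set \<Rightarrow> ('v set \<Rightarrow> complex) \<Rightarrow> bool" where
  "flexible_assignment V E lam \<longleftrightarrow>
     assignment E lam \<and>
     (\<exists>R. infinite R \<and> (\<forall>\<rho>\<in>R. realization V \<rho> \<and> compatible E lam \<rho>) \<and>
          pairwise (essentially_distinct V) R)"

datatype color = Red | Blue

text \<open>The end points \<open>v\<close> and \<open>t\<close> of an alternating path may coincide, so that in the absence of
  alternating paths every triangle is monochromatic. All other coincidences among the four
  vertices are excluded by the colors.\<close>

definition alternating_path ::
  "'v set set \<Rightarrow> ('v set \<Rightarrow> color) \<Rightarrow> 'v \<Rightarrow> 'v \<Rightarrow> 'v \<Rightarrow> 'v \<Rightarrow> bool" where
  "alternating_path E \<epsilon> v w z t \<longleftrightarrow>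
     {v, w} \<in> E \<and> {w, z} \<in> E \<and> {z, t} \<in> E \<and>
     \<epsilon> {v, w} = \<epsilon> {z, t} \<and> \<epsilon> {w, z} \<noteq> \<epsilon> {v, w}"

definition NAP_coloring :: "'v set set \<Rightarrow> ('v set \<Rightarrow> color) \<Rightarrow> bool" where
  "NAP_coloring E \<epsilon> \<longleftrightarrow> \<epsilon> ` E = UNIV \<and> \<not> (\<exists>v w z t. alternating_path E \<epsilon> v w z t)"

end

theory Submission
  imports Defs "HOL-Library.Function_Algebras" "HOL-Computational_Algebra.Polynomial"
begin

text \<open>Suppose that a flexible assignment exists. Normalising an edge and walking along the connected
  graph, one finds a path \<open>v, w, s\<close> and infinitely many compatible realizations in which \<open>w\<close> is the
  north pole, \<open>v\<close> is fixed and the isotropic coordinate \<open>t = x + iy\<close> of \<open>s\<close> takes infinitely many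
  values. In the ring of complex sequences, \<open>t\<close> is then transcendental over the constants, so there is a
  valuation that is trivial on the constants and positive at \<open>t\<close>. A point of the sphere is a pair of
  points of the projective line, and the spherical distance of two such points is a cross-ratio. As it
  is a constant different from 0 and 1, the four points of an edge cannot be split evenly by the open
  unit disc of the valuation. Color an edge red if at least three of its four points lie in the disc, and
  blue otherwise. Then there is no alternating path, and \<open>ws\<close> is red while \<open>vw\<close> is blue.\<close>

subsection \<open>Valuation pairs in commutative rings\<close>

text \<open>A subring together with a proper ideal of it. Ordered by inclusion in both components, the maximal
  pairs play the role of valuation rings, although the ambient ring (of sequences) is not a field.\<close>

definition proper_pair :: "'a::comm_ring_1 set \<Rightarrow> 'a set \<Rightarrow> bool" where
  "proper_pair A M \<longleftrightarrow>
     1 \<in> A \<and> (\<forall>x\<in>A. \<forall>y\<in>A. x - y \<in> A \<and> x * y \<in> A) \<and>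
     M \<subseteq> A \<and> 0 \<in> M \<and> (\<forall>x\<in>M. \<forall>y\<in>M. x + y \<in> M) \<and> (\<forall>a\<in>A. \<forall>x\<in>M. a * x \<in> M) \<and> 1 \<notin> M"

lemma proper_pairD:
  assumes "proper_pair A M"
  shows "1 \<in> A" "0 \<in> A" "0 \<in> M" "1 \<notin> M" "M \<subseteq> A"
    "\<And>x. x \<in> M \<Longrightarrow> x \<in> A"
    "\<And>x. x \<in> A \<Longrightarrow> - x \<in> A" "\<And>x. x \<in> M \<Longrightarrow> - x \<in> M"
    "\<And>x y. x \<in> A \<Longrightarrow> y \<in> A \<Longrightarrow> x - y \<in> A"
    "\<And>x y. x \<in> A \<Longrightarrow> y \<in> A \<Longrightarrow> x + y \<in> A"
    "\<And>x y. x \<in> A \<Longrightarrow> y \<in> A \<Longrightarrow> x * y \<in> A"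
    "\<And>x y. x \<in> M \<Longrightarrow> y \<in> M \<Longrightarrow> x + y \<in> M"
    "\<And>x y. x \<in> M \<Longrightarrow> y \<in> M \<Longrightarrow> x - y \<in> M"
    "\<And>x y. x \<in> A \<Longrightarrow> y \<in> M \<Longrightarrow> x * y \<in> M"
    "\<And>x y. x \<in> M \<Longrightarrow> y \<in> A \<Longrightarrow> x * y \<in> M"
proof -
  show one: "1 \<in> A" and "0 \<in> M" "1 \<notin> M" and MA: "M \<subseteq> A"
    and diff: "\<And>x y. x \<in> A \<Longrightarrow> y \<in> A \<Longrightarrow> x - y \<in> A"
    and "\<And>x y. x \<in> A \<Longrightarrow> y \<in> A \<Longrightarrow> x * y \<in> A"
    and addM: "\<And>x y. x \<in> M \<Longrightarrow> y \<in> M \<Longrightarrow> x + y \<in> M"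
    and mulM: "\<And>x y. x \<in> A \<Longrightarrow> y \<in> M \<Longrightarrow> x * y \<in> M"
    using assms by (auto simp: proper_pair_def)
  show "\<And>x. x \<in> M \<Longrightarrow> x \<in> A" using MA by auto
  show zero: "0 \<in> A" using diff[OF one one] by simp
  show neg: "- x \<in> A" if "x \<in> A" for x using diff[OF zero that] by simp
  show "x + y \<in> A" if "x \<in> A" "y \<in> A" for x y using diff[OF that(1) neg[OF that(2)]] by simp
  show negM: "- x \<in> M" if "x \<in> M" for x using mulM[OF neg[OF one] that] by simp
  show "x - y \<in> M" if "x \<in> M" "y \<in> M" for x y using addM[OF that(1) negM[OF that(2)]] by simp
  show "x * y \<in> M" if "x \<in> M" "y \<in> A" for x y using mulM[OF that(2) that(1)] by (simp add: mult.commute)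
qed

section \<open>Short polynomial relations for 1\<close>

text \<open>Used with \<open>I = J = M\<close> for \<open>x\<close> and with \<open>I = M\<close>,
  \<open>J = A\<close> for \<open>y\<close>, so that both halves of Chevalley's argument share the
  closure lemmas. The strict degree bound is what contradicts minimality.\<close>

definition poly_values :: "'a::comm_ring_1 set \<Rightarrow> 'a set \<Rightarrow> nat \<Rightarrow> 'a \<Rightarrow> 'a set" where
  "poly_values I J n x =
     {poly p x |p. coeff p 0 \<in> I \<and> (\<forall>i. coeff p (Suc i) \<in> J) \<and> degree p < n}"

lemma poly_values_add:
  assumes "\<And>a b. a \<in> I \<Longrightarrow> b \<in> I \<Longrightarrow> a + b \<in> I" "\<And>a b. a \<in> J \<Longrightarrow> b \<in> J \<Longrightarrow> a + b \<in> J"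
    and "a \<in> poly_values I J n x" "b \<in> poly_values I J n x"
  shows "a + b \<in> poly_values I J n x"
proof -
  obtain p q where "a = poly p x" "coeff p 0 \<in> I" "\<forall>i. coeff p (Suc i) \<in> J" "degree p < n"
    "b = poly q x" "coeff q 0 \<in> I" "\<forall>i. coeff q (Suc i) \<in> J" "degree q < n"
    using assms(3,4) by (auto simp: poly_values_def)
  then show ?thesis
    unfolding poly_values_def using assms(1,2)
    by (intro CollectI exI[of _ "p + q"]) (auto intro: degree_add_less)
qed

lemma poly_values_monom:
  assumes "0 \<in> I" "0 \<in> J" "i < n" "if i = 0 then a \<in> I else a \<in> J"
  shows "a * x ^ i \<in> poly_values I J n x"
  unfolding poly_values_def using assms
  by (intro CollectI exI[of _ "monom a i"])
    (auto simp: poly_monom coeff_monom split: if_splits intro: le_less_trans[OF degree_monom_le])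

lemma poly_values_sum:
  assumes "\<And>a b. a \<in> I \<Longrightarrow> b \<in> I \<Longrightarrow> a + b \<in> I" "\<And>a b. a \<in> J \<Longrightarrow> b \<in> J \<Longrightarrow> a + b \<in> J"
    and "0 \<in> I" "0 \<in> J" "0 < n" "finite K" "\<And>k. k \<in> K \<Longrightarrow> f k \<in> poly_values I J n x"
  shows "sum f K \<in> poly_values I J n x"
  using assms(6,7)
proof (induction K rule: finite_induct)
  case empty
  show ?case using poly_values_monom[of I J 0 n 0 x] assms(3-5) by simp
next
  case (insert k K)
  then show ?case using poly_values_add[of I J] assms(1,2) by simp
qed

text \<open>Multiplying \<open>poly q y = 1\<close> by \<open>x ^ degree p\<close> writes
  \<open>(1 - coeff q 0) * x ^ degree p\<close> in lower powers of \<open>x\<close>; this replaces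
  the top term of \<open>poly p x = 1\<close> multiplied by \<open>1 - coeff q 0\<close>. No
  division occurs, so any commutative ring will do.\<close>

lemma leading_term_elimination:
  fixes x y :: "'a::comm_ring_1"
  assumes xy: "x * y = 1" and p: "poly p x = 1" and q: "poly q y = 1" and le: "degree q \<le> degree p"
  shows "1 = coeff q 0 + (\<Sum>i<degree p. ((1 - coeff q 0) * coeff p i) * x ^ i)
           + (\<Sum>j\<in>{1..degree q}. (lead_coeff p * coeff q j) * x ^ (degree p - j))"
proof -
  let ?n = "degree p" and ?k = "degree q"
  have shift: "x ^ ?n * y ^ j = x ^ (?n - j)" if "j \<le> ?k" for j
  proof -
    have "x ^ ?n = x ^ (?n - j) * x ^ j" using that le by (simp flip: power_add)
    then have "x ^ ?n * y ^ j = x ^ (?n - j) * (x * y) ^ j"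
      by (simp add: power_mult_distrib mult.assoc)
    then show ?thesis by (simp add: xy)
  qed
  have "1 = coeff q 0 + (\<Sum>j\<in>{1..?k}. coeff q j * y ^ j)"
  proof -
    have "{..?k} = insert 0 {1..?k}" by auto
    then show ?thesis using q by (simp add: poly_altdef)
  qed
  then have "1 - coeff q 0 = (\<Sum>j\<in>{1..?k}. coeff q j * y ^ j)" by (simp add: algebra_simps)
  then have "(1 - coeff q 0) * x ^ ?n = (\<Sum>j\<in>{1..?k}. coeff q j * y ^ j) * x ^ ?n" by simp
  also have "\<dots> = (\<Sum>j\<in>{1..?k}. coeff q j * (x ^ ?n * y ^ j))"
    unfolding sum_distrib_right by (simp add: mult_ac)
  also have "\<dots> = (\<Sum>j\<in>{1..?k}. coeff q j * x ^ (?n - j))"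
    by (intro sum.cong) (auto simp: shift)
  finally have top: "(1 - coeff q 0) * x ^ ?n = (\<Sum>j\<in>{1..?k}. coeff q j * x ^ (?n - j))" .
  have "1 = (\<Sum>i<?n. coeff p i * x ^ i) + lead_coeff p * x ^ ?n"
    using p by (simp add: poly_altdef lessThan_Suc_atMost[symmetric])
  then have "1 - coeff q 0 = (1 - coeff q 0) * ((\<Sum>i<?n. coeff p i * x ^ i) + lead_coeff p * x ^ ?n)"
    by simp
  also have "\<dots> = (\<Sum>i<?n. ((1 - coeff q 0) * coeff p i) * x ^ i) + lead_coeff p * ((1 - coeff q 0) * x ^ ?n)"
    by (simp add: sum_distrib_left algebra_simps)
  also have "lead_coeff p * ((1 - coeff q 0) * x ^ ?n)
      = (\<Sum>j\<in>{1..?k}. (lead_coeff p * coeff q j) * x ^ (?n - j))"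
    unfolding top by (simp add: sum_distrib_left mult.assoc)
  finally show ?thesis by (simp add: algebra_simps)
qed

lemma coeff_mult_mem:
  assumes "0 \<in> I" "\<And>a b. a \<in> I \<Longrightarrow> b \<in> I \<Longrightarrow> a + b \<in> I"
    and "\<And>i j. i + j = n \<Longrightarrow> coeff p i * coeff q j \<in> I"
  shows "coeff (p * q) n \<in> (I :: 'a::comm_ring_1 set)"
proof -
  have "(\<Sum>i\<in>K. coeff p i * coeff q (n - i)) \<in> I" if "finite K" "K \<subseteq> {..n}" for K
    using that by (induction K rule: finite_induct) (auto simp: assms)
  then show ?thesis by (simp add: coeff_mult)
qed

text \<open>The new ring is A[x]; its ideal is generated by \<open>M\<close> if
  \<open>J = M\<close>, and by \<open>M\<close> and \<open>x\<close> if \<open>J = A\<close>.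
  Assumption \<open>no\<close> keeps 1 out of the ideal.\<close>

lemma proper_pair_adjoin:
  fixes A M :: "'a::comm_ring_1 set"
  assumes pp: "proper_pair A M" and J: "J = M \<or> J = A"
    and no: "\<And>p. coeff p 0 \<in> M \<Longrightarrow> (\<And>i. coeff p (Suc i) \<in> J) \<Longrightarrow> poly p x \<noteq> 1"
  obtains A' M' where "proper_pair A' M'" "A \<subseteq> A'" "M \<subseteq> M'" "x \<in> A'" "J = A \<Longrightarrow> x \<in> M'"
proof
  note D = proper_pairD[OF pp]
  let ?A = "{poly p x |p. \<forall>i. coeff p i \<in> A}"
  let ?M = "{poly p x |p. coeff p 0 \<in> M \<and> (\<forall>i. coeff p (Suc i) \<in> J)}"
  have JA: "j \<in> J \<Longrightarrow> j \<in> A" and J0: "0 \<in> J" for j using J D by auto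
  have MJ: "m \<in> J" if "m \<in> M" for m using J D that by auto
  have Jadd: "i + j \<in> J" if "i \<in> J" "j \<in> J" for i j using that J D by auto
  have Jmul: "a * j \<in> J" if "a \<in> A" "j \<in> J" for a j using that J D by auto
  have A1: "poly p x - poly q x \<in> ?A \<and> poly p x * poly q x \<in> ?A"
    if "\<forall>i. coeff p i \<in> A" "\<forall>i. coeff q i \<in> A" for p q
  proof
    show "poly p x - poly q x \<in> ?A"
      using that D by (intro CollectI exI[of _ "p - q"]) auto
    show "poly p x * poly q x \<in> ?A"
      using that D by (intro CollectI exI[of _ "p * q"]) (auto intro: coeff_mult_mem)
  qed
  have M1: "poly p x * poly q x \<in> ?M"
    if "\<forall>i. coeff p i \<in> A" "coeff q 0 \<in> M" "\<forall>i. coeff q (Suc i) \<in> J" for p q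
  proof (intro CollectI exI[of _ "p * q"] conjI allI)
    have qJ: "coeff q j \<in> J" for j using that MJ by (cases j) auto
    show "coeff (p * q) 0 \<in> M" using that D by (auto simp: coeff_mult)
    show "coeff (p * q) (Suc i) \<in> J" for i
      using that qJ Jmul Jadd J0 by (intro coeff_mult_mem) auto
  qed simp
  have M2: "poly p x + poly q x \<in> ?M"
    if "coeff p 0 \<in> M" "\<forall>i. coeff p (Suc i) \<in> J" "coeff q 0 \<in> M" "\<forall>i. coeff q (Suc i) \<in> J" for p q
    using that D Jadd by (intro CollectI exI[of _ "p + q"]) auto
  have MA: "?M \<subseteq> ?A"
  proof
    fix m assume "m \<in> ?M"
    then obtain p where p: "m = poly p x" "coeff p 0 \<in> M" "\<forall>i. coeff p (Suc i) \<in> J" by auto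
    have "coeff p i \<in> A" for i using p JA D by (cases i) auto
    then show "m \<in> ?A" using p by auto
  qed
  show sA: "A \<subseteq> ?A"
  proof
    fix a assume "a \<in> A"
    then show "a \<in> ?A" using D
      by (intro CollectI exI[of _ "[:a:]"]) (auto simp: coeff_pCons split: nat.splits)
  qed
  show sM: "M \<subseteq> ?M"
  proof
    fix a assume "a \<in> M"
    then show "a \<in> ?M" using J0
      by (intro CollectI exI[of _ "[:a:]"]) (auto simp: coeff_pCons split: nat.splits)
  qed
  show "x \<in> ?A" using D
    by (intro CollectI exI[of _ "[:0,1:]"]) (auto simp: coeff_pCons split: nat.splits)
  show "x \<in> ?M" if "J = A" using D that
    by (intro CollectI exI[of _ "[:0,1:]"]) (auto simp: coeff_pCons split: nat.splits)
  have "1 \<notin> ?M" using no by auto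
  moreover have "\<forall>a\<in>?A. \<forall>b\<in>?A. a - b \<in> ?A \<and> a * b \<in> ?A" using A1 by blast
  moreover have "\<forall>a\<in>?M. \<forall>b\<in>?M. a + b \<in> ?M" using M2 by blast
  moreover have "\<forall>a\<in>?A. \<forall>b\<in>?M. a * b \<in> ?M" using M1 by blast
  ultimately show "proper_pair ?A ?M"
    unfolding proper_pair_def using sA sM MA D(1,3) by blast
qed

text \<open>Chevalley's extension argument: if neither \<open>x\<close> can be adjoined to \<open>A\<close> nor \<open>y\<close> to \<open>M\<close>, then 1 is
  a polynomial in \<open>x\<close> over \<open>M\<close> and a polynomial in \<open>y\<close> over \<open>A\<close> with constant term in \<open>M\<close>; the one of
  larger degree can be shortened by the other.\<close>

lemma maximal_pair_valuation:
  fixes A M :: "'a::comm_ring_1 set"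
  assumes pp: "proper_pair A M"
    and max: "\<And>A' M'. proper_pair A' M' \<Longrightarrow> A \<subseteq> A' \<Longrightarrow> M \<subseteq> M' \<Longrightarrow> A' = A \<and> M' = M"
    and xy: "x * y = 1"
  shows "x \<in> A \<or> y \<in> M"
proof (rule ccontr)
  assume neg: "\<not> (x \<in> A \<or> y \<in> M)"
  note D = proper_pairD[OF pp]
  define P where "P p \<longleftrightarrow> coeff p 0 \<in> M \<and> (\<forall>i. coeff p (Suc i) \<in> M) \<and> poly p x = 1" for p
  define Q where "Q p \<longleftrightarrow> coeff p 0 \<in> M \<and> (\<forall>i. coeff p (Suc i) \<in> A) \<and> poly p y = 1" for p
  have "\<exists>p. P p"
    using proper_pair_adjoin[OF pp, of M x] max neg unfolding P_def by metis
  then obtain p where p: "P p" and pmin: "\<And>p'. degree p' < degree p \<Longrightarrow> \<not> P p'"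
    using ex_has_least_nat[of P _ degree] by (metis not_le)
  have "\<exists>p. Q p"
    using proper_pair_adjoin[OF pp, of A y] max neg unfolding Q_def by metis
  then obtain q where q: "Q q" and qmin: "\<And>p'. degree p' < degree q \<Longrightarrow> \<not> Q p'"
    using ex_has_least_nat[of Q _ degree] by (metis not_le)
  have pM: "coeff p i \<in> M" for i using p by (cases i) (auto simp: P_def)
  have qA: "coeff q i \<in> A" for i using q D by (cases i) (auto simp: Q_def)
  have q0: "coeff q 0 \<in> M" using q by (auto simp: Q_def)
  \<comment> \<open>A constant relation would put 1 itself into \<open>M\<close>; positive degrees
    leave room for a constant term below the degree bound.\<close>
  have nz: "degree r \<noteq> 0" if "coeff r 0 \<in> M" "poly r z = 1" for r :: "'a poly" and z
    using that D(4) by (metis (no_types) add.right_neutral coeff_pCons_0 degree_eq_zeroE mult_zero_right poly_0 poly_pCons)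
  have pn: "degree p > 0" using nz[of p x] p by (auto simp: P_def)
  have qn: "degree q > 0" using nz[of q y] q by (auto simp: Q_def)
  show False
  proof (cases "degree q \<le> degree p")
    \<comment> \<open>Every coefficient produced is \<open>coeff q 0\<close> or has a factor from
      \<open>p\<close>, hence lies in \<open>M\<close>.\<close>
    case True
    have "coeff q 0 \<in> poly_values M M (degree p) x"
      using poly_values_monom[of M M 0 "degree p" "coeff q 0" x] D pn q0 by simp
    moreover have "(\<Sum>i<degree p. ((1 - coeff q 0) * coeff p i) * x ^ i) \<in> poly_values M M (degree p) x"
      using D pn pM q0 by (intro poly_values_sum poly_values_monom) auto
    moreover have "(\<Sum>j\<in>{1..degree q}. (lead_coeff p * coeff q j) * x ^ (degree p - j))
        \<in> poly_values M M (degree p) x"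
      using D pn pM qA by (intro poly_values_sum poly_values_monom) auto
    ultimately have "coeff q 0 + (\<Sum>i<degree p. ((1 - coeff q 0) * coeff p i) * x ^ i)
        + (\<Sum>j\<in>{1..degree q}. (lead_coeff p * coeff q j) * x ^ (degree p - j))
        \<in> poly_values M M (degree p) x"
      using D by (intro poly_values_add) auto
    then have "1 \<in> poly_values M M (degree p) x"
      using leading_term_elimination[OF xy _ _ True] p q by (simp add: P_def Q_def)
    then obtain p' where "1 = poly p' x" "coeff p' 0 \<in> M" "\<forall>i. coeff p' (Suc i) \<in> M"
      "degree p' < degree p"
      unfolding poly_values_def by blast
    then show False using pmin[of p'] unfolding P_def by simp
  next
    \<comment> \<open>With the roles exchanged, only the constant term has to lie in
      \<open>M\<close>; it does because \<open>coeff q 0\<close> and all coefficients of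
      \<open>p\<close> do.\<close>
    case False
    have yx: "y * x = 1" using xy by (simp add: mult.commute)
    have "coeff p 0 \<in> poly_values M A (degree q) y"
      using poly_values_monom[of M A 0 "degree q" "coeff p 0" y] D qn pM by simp
    moreover have "(\<Sum>i<degree q. ((1 - coeff p 0) * coeff q i) * y ^ i) \<in> poly_values M A (degree q) y"
      using D qn pM qA q0 by (intro poly_values_sum poly_values_monom) auto
    moreover have "(\<Sum>j\<in>{1..degree p}. (lead_coeff q * coeff p j) * y ^ (degree q - j))
        \<in> poly_values M A (degree q) y"
      using D qn pM qA False by (intro poly_values_sum poly_values_monom) auto
    ultimately have "coeff p 0 + (\<Sum>i<degree q. ((1 - coeff p 0) * coeff q i) * y ^ i)
        + (\<Sum>j\<in>{1..degree p}. (lead_coeff q * coeff p j) * y ^ (degree q - j))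
        \<in> poly_values M A (degree q) y"
      using D by (intro poly_values_add) auto
    then have "1 \<in> poly_values M A (degree q) y"
      using leading_term_elimination[OF yx, of q p] False p q by (simp add: P_def Q_def)
    then obtain p' where "1 = poly p' y" "coeff p' 0 \<in> M" "\<forall>i. coeff p' (Suc i) \<in> A"
      "degree p' < degree q"
      unfolding poly_values_def by blast
    then show False using qmin[of p'] unfolding Q_def by simp
  qed
qed

section \<open>Existence of valuation pairs by Zorn's lemma\<close>

lemma proper_pair_chain_Union:
  fixes \<C> :: "('a::comm_ring_1 set \<times> 'a set) set"
  assumes "\<C> \<noteq> {}" and pp: "\<And>A M. (A, M) \<in> \<C> \<Longrightarrow> proper_pair A M"
    and chain: "\<And>c d. c \<in> \<C> \<Longrightarrow> d \<in> \<C> \<Longrightarrow>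
      fst c \<subseteq> fst d \<and> snd c \<subseteq> snd d \<or> fst d \<subseteq> fst c \<and> snd d \<subseteq> snd c"
  shows "proper_pair (\<Union>(fst ` \<C>)) (\<Union>(snd ` \<C>))"
proof -
  obtain A0 M0 where 0: "(A0, M0) \<in> \<C>" using assms(1) by auto
  note D0 = proper_pairD[OF pp[OF 0]]
  have dir: "\<exists>e\<in>\<C>. fst c \<subseteq> fst e \<and> snd c \<subseteq> snd e \<and> fst d \<subseteq> fst e \<and> snd d \<subseteq> snd e"
    if "c \<in> \<C>" "d \<in> \<C>" for c d using chain[OF that] that by blast
  have A: "x - y \<in> \<Union>(fst ` \<C>) \<and> x * y \<in> \<Union>(fst ` \<C>)"
    if xy: "x \<in> \<Union>(fst ` \<C>)" "y \<in> \<Union>(fst ` \<C>)" for x y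
  proof -
    obtain c\<^sub>1 c\<^sub>2 where "c\<^sub>1 \<in> \<C>" "x \<in> fst c\<^sub>1" "c\<^sub>2 \<in> \<C>" "y \<in> fst c\<^sub>2" using xy by blast
    then obtain c where c: "c \<in> \<C>" "x \<in> fst c" "y \<in> fst c" using dir[of c\<^sub>1 c\<^sub>2] by blast
    then have "proper_pair (fst c) (snd c)" using pp by (cases c) auto
    then have "x - y \<in> fst c" "x * y \<in> fst c" using c proper_pairD(9,11) by blast+
    then show ?thesis using c by blast
  qed
  have M: "x + y \<in> \<Union>(snd ` \<C>)"
    if xy: "x \<in> \<Union>(snd ` \<C>)" "y \<in> \<Union>(snd ` \<C>)" for x y
  proof -
    obtain c\<^sub>1 c\<^sub>2 where "c\<^sub>1 \<in> \<C>" "x \<in> snd c\<^sub>1" "c\<^sub>2 \<in> \<C>" "y \<in> snd c\<^sub>2" using xy by blast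
    then obtain c where c: "c \<in> \<C>" "x \<in> snd c" "y \<in> snd c" using dir[of c\<^sub>1 c\<^sub>2] by blast
    then have "proper_pair (fst c) (snd c)" using pp by (cases c) auto
    then have "x + y \<in> snd c" using c proper_pairD(12) by blast
    then show ?thesis using c by blast
  qed
  have AM: "x * y \<in> \<Union>(snd ` \<C>)"
    if xy: "x \<in> \<Union>(fst ` \<C>)" "y \<in> \<Union>(snd ` \<C>)" for x y
  proof -
    obtain c\<^sub>1 c\<^sub>2 where "c\<^sub>1 \<in> \<C>" "x \<in> fst c\<^sub>1" "c\<^sub>2 \<in> \<C>" "y \<in> snd c\<^sub>2" using xy by blast
    then obtain c where c: "c \<in> \<C>" "x \<in> fst c" "y \<in> snd c" using dir[of c\<^sub>1 c\<^sub>2] by blast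
    then have "proper_pair (fst c) (snd c)" using pp by (cases c) auto
    then have "x * y \<in> snd c" using c proper_pairD(14) by blast
    then show ?thesis using c by blast
  qed
  have "\<Union>(snd ` \<C>) \<subseteq> \<Union>(fst ` \<C>)"
  proof clarify
    fix x a b assume "(a, b) \<in> \<C>" "x \<in> snd (a, b)"
    then show "x \<in> \<Union>(fst ` \<C>)" using proper_pairD(6)[OF pp] by force
  qed
  moreover have "1 \<notin> \<Union>(snd ` \<C>)" using proper_pairD(4)[OF pp] by force
  moreover have "1 \<in> \<Union>(fst ` \<C>)" using UN_I[OF 0, of 1 fst] D0(1) by simp
  moreover have "0 \<in> \<Union>(snd ` \<C>)" using UN_I[OF 0, of 0 snd] D0(3) by simp
  ultimately show ?thesis unfolding proper_pair_def using A M AM by simp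
qed

lemma valuation_pair_exists:
  fixes A\<^sub>0 M\<^sub>0 :: "'a::comm_ring_1 set"
  assumes pp0: "proper_pair A\<^sub>0 M\<^sub>0"
  obtains A M where "proper_pair A M" "A\<^sub>0 \<subseteq> A" "M\<^sub>0 \<subseteq> M" "\<And>x y. x * y = 1 \<Longrightarrow> x \<in> A \<or> y \<in> M"
proof -
  \<comment> \<open>The disjoint sum turns componentwise inclusion of pairs into inclusion of single
    sets, the order in which Zorn's lemma is applied.\<close>
  define enc :: "('a set \<times> 'a set) \<Rightarrow> ('a + 'a) set" where "enc = (\<lambda>(A, M). A <+> M)"
  define \<P> where "\<P> = {(A, M). proper_pair A M \<and> A\<^sub>0 \<subseteq> A \<and> M\<^sub>0 \<subseteq> M}"
  have enc_le: "enc c \<subseteq> enc d \<longleftrightarrow> fst c \<subseteq> fst d \<and> snd c \<subseteq> snd d" for c d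
    by (cases c; cases d) (auto simp: enc_def)
  have "\<exists>Z\<in>enc ` \<P>. \<forall>X\<in>enc ` \<P>. Z \<subseteq> X \<longrightarrow> X = Z"
  proof (rule subset_Zorn_nonempty)
    show "enc ` \<P> \<noteq> {}" using pp0 by (auto simp: \<P>_def)
    fix \<Z> assume ne: "\<Z> \<noteq> {}" and ch: "subset.chain (enc ` \<P>) \<Z>"
    then obtain \<C> where \<C>: "\<C> \<subseteq> \<P>" "\<Z> = enc ` \<C>"
      by (meson subset.chain_def subset_imageE)
    then have "\<C> \<noteq> {}" using ne by auto
    have "proper_pair (\<Union>(fst ` \<C>)) (\<Union>(snd ` \<C>))"
    proof (rule proper_pair_chain_Union)
      show "\<C> \<noteq> {}" by fact
      show "proper_pair A M" if "(A, M) \<in> \<C>" for A M using that \<C> by (auto simp: \<P>_def)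
      show "fst c \<subseteq> fst d \<and> snd c \<subseteq> snd d \<or> fst d \<subseteq> fst c \<and> snd d \<subseteq> snd c"
        if "c \<in> \<C>" "d \<in> \<C>" for c d
      proof -
        have "enc c \<in> \<Z>" "enc d \<in> \<Z>" using that \<C>(2) by auto
        then have "enc c \<subseteq> enc d \<or> enc d \<subseteq> enc c" using ch by (auto simp: subset_chain_def)
        then show ?thesis by (simp add: enc_le)
      qed
    qed
    moreover have "A\<^sub>0 \<subseteq> \<Union>(fst ` \<C>)" "M\<^sub>0 \<subseteq> \<Union>(snd ` \<C>)"
      using \<open>\<C> \<noteq> {}\<close> \<C>(1) by (force simp: \<P>_def)+
    ultimately have "(\<Union>(fst ` \<C>), \<Union>(snd ` \<C>)) \<in> \<P>" by (simp add: \<P>_def)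
    moreover have "\<Union>\<Z> = enc (\<Union>(fst ` \<C>), \<Union>(snd ` \<C>))"
      unfolding \<C>(2) enc_def by force
    ultimately show "\<Union>\<Z> \<in> enc ` \<P>" by blast
  qed
  then obtain A M where AM: "(A, M) \<in> \<P>"
    and max: "\<And>d. d \<in> \<P> \<Longrightarrow> enc (A, M) \<subseteq> enc d \<Longrightarrow> enc d = enc (A, M)"
    by force
  have pp: "proper_pair A M" and sub: "A\<^sub>0 \<subseteq> A" "M\<^sub>0 \<subseteq> M" using AM by (auto simp: \<P>_def)
  show thesis
  proof (rule that[OF pp sub])
    fix x y :: 'a assume xy: "x * y = 1"
    show "x \<in> A \<or> y \<in> M"
    proof (rule maximal_pair_valuation[OF pp _ xy])
      fix A' M' assume *: "proper_pair A' M'" "A \<subseteq> A'" "M \<subseteq> M'"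
      then have "(A', M') \<in> \<P>" using sub by (auto simp: \<P>_def)
      with max[of "(A', M')"] * have "enc (A', M') \<subseteq> enc (A, M)" by (simp add: enc_le)
      then show "A' = A \<and> M' = M" using * by (auto simp: enc_le)
    qed
  qed
qed

subsection \<open>Valuations of points on the sphere\<close>

text \<open>For a point of the sphere with isotropic coordinates \<open>u = x + iy\<close>, \<open>w = x - iy\<close> and third
  coordinate \<open>z\<close>, so that \<open>uw + z\<^sup>2 = 1\<close>, the two predicates \<open>dominant A u z\<close> (below: low) and
  \<open>dominant M w z\<close> (below: hi) say that none or both, respectively, of the two points of the projective
  line attached to it lie in the open unit disc of the valuation. In the remaining case exactly one does.\<close>

definition dominant :: "'a::comm_ring_1 set \<Rightarrow> 'a \<Rightarrow> 'a \<Rightarrow> bool" where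
  "dominant A u z \<longleftrightarrow> (\<exists>i. u * i = 1 \<and> i \<in> A \<and> z * i \<in> A)"

text \<open>In terms of absolute values, \<open>nlo\<close> says that \<open>u\<close> is smaller
  than 1 or than \<open>z\<close>. If \<open>z\<close> is in \<open>A\<close>, then \<open>u\<close>
  is in \<open>M\<close>, and \<open>nhi\<close> bounds \<open>w\<close>. Otherwise the sphere
  equation divided by \<open>z * z\<close> makes \<open>w\<close> larger than \<open>z\<close>,
  contradicting \<open>nhi\<close>. The zero-or-unit assumptions supply the inverses that a field
  would have.\<close>

lemma valuation_trichotomy:
  fixes u w z :: "'a::comm_ring_1"
  assumes pp: "proper_pair A M" and val: "\<And>x y. x * y = 1 \<Longrightarrow> x \<in> A \<or> y \<in> M"
    and sph: "u * w + z * z = 1"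
    and u: "u = 0 \<or> u dvd 1" and w: "w = 0 \<or> w dvd 1" and z: "z = 0 \<or> z dvd 1"
    and nlo: "\<not> dominant A u z" and nhi: "\<not> dominant M w z"
  shows "u \<in> M \<and> z \<in> A \<and> w \<in> A"
proof -
  note D = proper_pairD[OF pp]
  have hi: "z \<in> A \<Longrightarrow> w \<in> A"
  proof (rule ccontr)
    assume "z \<in> A" "w \<notin> A"
    then obtain j where j: "w * j = 1" using w D by (auto elim!: dvdE)
    then have "j \<in> M" using val \<open>w \<notin> A\<close> by blast
    then have "z * j \<in> M" by (intro D(14) \<open>z \<in> A\<close>)
    then show False using nhi j \<open>j \<in> M\<close> unfolding dominant_def by blast
  qed
  have uz: "u \<in> M \<or> (\<exists>k. z * k = 1 \<and> u * k \<in> M)"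
  proof (cases "u = 0")
    case False
    then obtain i where i: "u * i = 1" using u by (auto elim!: dvdE)
    show ?thesis
    proof (cases "i \<in> A")
      case True
      then have zi: "z * i \<notin> A" using nlo i by (auto simp: dominant_def)
      then have "z \<noteq> 0" using D by auto
      then obtain k where k: "z * k = 1" using z by (auto elim!: dvdE)
      have "(z * i) * (u * k) = (z * k) * (u * i)" by (simp add: mult_ac)
      then have "(z * i) * (u * k) = 1" using k i by simp
      then show ?thesis using val zi k by blast
    qed (use val[of i u] i in \<open>auto simp: mult.commute\<close>)
  qed (use D in auto)
  show ?thesis
  proof (cases "z \<in> A")
    case True
    have "u \<in> M" using uz
    proof
      assume "\<exists>k. z * k = 1 \<and> u * k \<in> M"
      then obtain k where k: "z * k = 1" "u * k \<in> M" by blast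
      have "u = z * (u * k)" using k(1) by (metis mult.left_commute mult.right_neutral)
      then show ?thesis using D(14)[OF True k(2)] by simp
    qed
    then show ?thesis using True hi by simp
  next
    case False
    then have "z \<noteq> 0" using D by auto
    then obtain k where k: "z * k = 1" using z by (auto elim!: dvdE)
    have kM: "k \<in> M" using val k False by blast
    have uk: "u * k \<in> M" using uz
    proof
      assume "\<exists>k. z * k = 1 \<and> u * k \<in> M"
      then obtain k' where k': "z * k' = 1" "u * k' \<in> M" by blast
      have "k' = k" using k k' by (metis mult.left_commute mult.right_neutral)
      then show ?thesis using k' by simp
    qed (use kM D in auto)
    have "w * k \<notin> A"
    proof
      assume wk: "w * k \<in> A"
      have "k * k = (u * w + z * z) * (k * k)" using sph by simp
      also have "\<dots> = (u * k) * (w * k) + (z * k) * (z * k)" by (simp add: algebra_simps)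
      finally have "1 = k * k - (u * k) * (w * k)" using k by simp
      also have "\<dots> \<in> M" by (intro D(13) D(15) D(6) kM uk wk)
      finally show False using D by simp
    qed
    then have "w \<noteq> 0" using D by auto
    then obtain j where j: "w * j = 1" using w by (auto elim!: dvdE)
    have "(w * k) * (z * j) = (w * j) * (z * k)" by (simp add: mult_ac)
    then have "(w * k) * (z * j) = 1" using j k by simp
    then have zj: "z * j \<in> M" using val \<open>w * k \<notin> A\<close> by blast
    have "j = (z * j) * k" using k by (metis mult.assoc mult.commute mult.right_neutral)
    then have "j \<in> M" using D(15)[OF zj D(6)[OF kM]] by simp
    then show ?thesis using nhi j zj by (auto simp: dominant_def)
  qed
qed

section \<open>Which pairs of points can be adjacent\<close>

text \<open>The sphere equation divided by \<open>u * u\<close>; it bounds the quotient of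
  \<open>w\<close> by \<open>u\<close> once those of 1 and \<open>z\<close> are bounded.\<close>

lemma dominant_conjugate:
  fixes u w z :: "'a::comm_ring_1"
  assumes "u * w + z * z = 1" "u * i = 1"
  shows "w * i = i * i - (z * i) * (z * i)"
proof -
  have "w * i = (u * i) * (w * i)" using assms by simp
  also have "\<dots> = (u * w + z * z) * (i * i) - (z * i) * (z * i)" by (simp add: algebra_simps)
  finally show ?thesis using assms by simp
qed

text \<open>Divide the edge equation by \<open>w * u'\<close>. The quotients of 1, \<open>z\<close>,
  \<open>u\<close> by \<open>w\<close> are in \<open>M\<close> and those of 1, \<open>z'\<close>,
  \<open>w'\<close> by \<open>u'\<close> are in \<open>A\<close>, so 1 would be in
  \<open>M\<close>.\<close>

lemma hi_lo_not_adjacent: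
  fixes u w z :: "'a::comm_ring_1"
  assumes pp: "proper_pair A M" and c: "c \<in> A"
    and sph: "u * w + z * z = 1" and sph': "u' * w' + z' * z' = 1"
    and edge: "2 * c = 2 * (z * z') + u * w' + w * u'"
    and hi: "dominant M w z" and dominant: "dominant A u' z'"
  shows False
proof -
  note D = proper_pairD[OF pp]
  obtain j where j: "w * j = 1" "j \<in> M" "z * j \<in> M" using hi by (auto simp: dominant_def)
  obtain i where i: "u' * i = 1" "i \<in> A" "z' * i \<in> A" using dominant by (auto simp: dominant_def)
  have uj: "u * j \<in> M"
    using dominant_conjugate[of w u z j] sph j D(13)[OF D(15)[OF j(2) D(6)[OF j(2)]] D(15)[OF j(3) D(6)[OF j(3)]]]
    by (simp add: mult.commute)
  have wi: "w' * i \<in> A"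
    using dominant_conjugate[of u' w' z' i] sph' i D(9)[OF D(11)[OF i(2) i(2)] D(11)[OF i(3) i(3)]] by simp
  have two: "2 \<in> A" using D(1) D(10)[of 1 1] by simp
  have "1 = (w * j) * (u' * i)" using i j by simp
  also have "\<dots> = 2 * c * i * j - 2 * (z' * i) * (z * j) - (w' * i) * (u * j)"
    unfolding edge by (simp add: algebra_simps)
  also have "\<dots> \<in> M"
    by (intro D(13) D(14) D(11) two c i(2,3) j(2,3) uj wi)
  finally show False using D by simp
qed

text \<open>Modulo \<open>M\<close> both \<open>u\<close> and \<open>u'\<close> vanish, so
  \<open>z\<close> and \<open>z'\<close> square to 1 and \<open>c\<close> is congruent to
  \<open>z * z'\<close>. Hence \<open>c * c - 1\<close> is in \<open>M\<close>, although it has the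
  inverse \<open>d\<close> in \<open>A\<close>.\<close>

lemma mid_mid_not_adjacent:
  fixes u w z :: "'a::comm_ring_1"
  assumes pp: "proper_pair A M" and half: "2 * h = 1" "h \<in> A" and c: "c \<in> A"
    and d: "(c * c - 1) * d = 1" "d \<in> A"
    and sph: "u * w + z * z = 1" and sph': "u' * w' + z' * z' = 1"
    and edge: "2 * c = 2 * (z * z') + u * w' + w * u'"
    and mid: "u \<in> M" "z \<in> A" "w \<in> A" and mid': "u' \<in> M" "z' \<in> A" "w' \<in> A"
  shows False
proof -
  note D = proper_pairD[OF pp]
  define e where "e = h * (w' * u + w * u')"
  have e: "e \<in> M" unfolding e_def by (intro D(14) D(12) half mid mid')
  have "c = h * (2 * c)" using half by (metis mult.assoc mult.commute mult.left_neutral)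
  also have "\<dots> = (2 * h) * (z * z') + e"
    unfolding edge e_def by (simp add: algebra_simps)
  finally have c_eq: "c = z * z' + e" using half by simp
  have zz: "(z * z') * (z * z') = (1 - u * w) * (1 - u' * w')"
  proof -
    have "(z * z') * (z * z') = (z * z) * (z' * z')" by (simp add: mult_ac)
    moreover have "z * z = 1 - u * w" "z' * z' = 1 - u' * w'"
      using sph sph' by (simp_all add: algebra_simps)
    ultimately show ?thesis by simp
  qed
  have "c * c - 1 = (z * z') * (z * z') - 1 + (c + z * z') * e"
    unfolding c_eq by (simp add: algebra_simps)
  also have "\<dots> = (c + z * z') * e - w * u - (1 - u * w) * (w' * u')"
    unfolding zz by (simp add: algebra_simps)
  also have "\<dots> \<in> M"
  proof -
    have "c + z * z' \<in> A" "1 - u * w \<in> A" by (intro D(10) D(9) D(11) D(1) D(6)[OF mid(1)] c mid(2,3) mid'(2))+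
    then show ?thesis by (intro D(13) D(14) e mid mid')
  qed
  finally have "1 \<in> M" using D(15)[OF _ d(2)] d(1) by metis
  then show False using D by simp
qed

text \<open>The pair to be extended consists of the polynomials in \<open>t\<close> and the
  multiples of \<open>t\<close> among them. It is proper because a nonzero polynomial cannot vanish
  at infinitely many values.\<close>

lemma valuation_pair_on_sequences:
  fixes t :: "nat \<Rightarrow> complex"
  assumes inf: "infinite (range t)"
  obtains A M where "proper_pair A M" "\<And>x y. x * y = 1 \<Longrightarrow> x \<in> A \<or> y \<in> M"
    "\<And>c. (\<lambda>_. c) \<in> A" "t \<in> M"
proof -
  define A where "A = range (\<lambda>p n. poly p (t n))"
  define M where "M = range (\<lambda>p n. t n * poly p (t n))"
  have "proper_pair A M"
    unfolding proper_pair_def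
  proof (intro conjI ballI)
    show "1 \<in> A" unfolding A_def by (rule range_eqI[of _ _ 1]) auto
    show "0 \<in> M" unfolding M_def by (rule range_eqI[of _ _ 0]) auto
    show "M \<subseteq> A"
    proof
      fix x assume "x \<in> M"
      then obtain p where "x = (\<lambda>n. t n * poly p (t n))" by (auto simp: M_def)
      then show "x \<in> A" unfolding A_def by (intro range_eqI[of _ _ "pCons 0 p"]) auto
    qed
    show "1 \<notin> M"
    proof
      assume "1 \<in> M"
      then obtain p where p: "(1 :: nat \<Rightarrow> complex) = (\<lambda>n. t n * poly p (t n))" by (auto simp: M_def)
      \<comment> \<open>\<open>pCons (-1) p\<close> is the polynomial X p(X) - 1.\<close>
      have "poly (pCons (-1) p) (t n) = 0" for n
        using fun_cong[OF p, of n] by (simp add: algebra_simps)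
      then have "range t \<subseteq> {x. poly (pCons (-1) p) x = 0}" by auto
      moreover have "pCons (-1) p \<noteq> 0" by simp
      ultimately show False using inf poly_roots_finite finite_subset by blast
    qed
  next
    fix x y assume "x \<in> A" "y \<in> A"
    then obtain p q where pq: "x = (\<lambda>n. poly p (t n))" "y = (\<lambda>n. poly q (t n))" by (auto simp: A_def)
    show "x - y \<in> A" unfolding A_def pq by (intro range_eqI[of _ _ "p - q"]) auto
    show "x * y \<in> A" unfolding A_def pq by (intro range_eqI[of _ _ "p * q"]) auto
  next
    fix x y assume "x \<in> M" "y \<in> M"
    then obtain p q where pq: "x = (\<lambda>n. t n * poly p (t n))" "y = (\<lambda>n. t n * poly q (t n))" by (auto simp: M_def)
    show "x + y \<in> M" unfolding M_def pq
      by (intro range_eqI[of _ _ "p + q"]) (auto simp: algebra_simps)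
  next
    fix x y assume "x \<in> A" "y \<in> M"
    then obtain p q where pq: "x = (\<lambda>n. poly p (t n))" "y = (\<lambda>n. t n * poly q (t n))"
      by (auto simp: M_def A_def)
    show "x * y \<in> M" unfolding M_def pq
      by (intro range_eqI[of _ _ "p * q"]) (auto simp: algebra_simps)
  qed
  then obtain A' M' where *: "proper_pair A' M'" "A \<subseteq> A'" "M \<subseteq> M'" "\<And>x y. x * y = 1 \<Longrightarrow> x \<in> A' \<or> y \<in> M'"
    using valuation_pair_exists[of A M] by metis
  have c: "(\<lambda>_. c) \<in> A" for c unfolding A_def by (rule range_eqI[of _ _ "[:c:]"]) auto
  have t: "t \<in> M" unfolding M_def by (rule range_eqI[of _ _ 1]) auto
  show thesis
    by (rule that[OF *(1) *(4) subsetD[OF *(2) c] subsetD[OF *(3) t]])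
qed

subsection \<open>The group of rotations\<close>

lemma bilin_3: "bilin T U = T $ 1 * U $ 1 + T $ 2 * U $ 2 + T $ 3 * U $ 3"
  by (simp add: bilin_def sum_3)

lemma sphere2C_iff: "T \<in> sphere2C \<longleftrightarrow> bilin T T = 1"
  by (simp add: sphere2C_def bilin_3 power2_eq_square)

lemma bilin_matrix_transpose: "bilin (\<sigma> *v T) U = bilin T (transpose \<sigma> *v U)"
  by (simp add: bilin_3 matrix_vector_mult_def transpose_def sum_3 algebra_simps)

lemma SO3C_bilin: "\<sigma> \<in> SO3C \<Longrightarrow> bilin (\<sigma> *v T) (\<sigma> *v U) = bilin T U"
  by (simp add: SO3C_def bilin_matrix_transpose matrix_vector_mul_assoc)

lemma SO3C_sphere: "\<sigma> \<in> SO3C \<Longrightarrow> T \<in> sphere2C \<Longrightarrow> \<sigma> *v T \<in> sphere2C"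
  by (simp add: sphere2C_iff SO3C_bilin)

lemma SO3C_transpose: "\<sigma> \<in> SO3C \<Longrightarrow> transpose \<sigma> \<in> SO3C"
  by (simp add: SO3C_def)

lemma SO3C_mult: "\<sigma> \<in> SO3C \<Longrightarrow> \<tau> \<in> SO3C \<Longrightarrow> \<sigma> ** \<tau> \<in> SO3C"
  unfolding SO3C_def
  by (auto simp: matrix_transpose_mul det_mul) (metis matrix_mul_assoc matrix_mul_lid)+

text \<open>The last row is the cross product, which completes two points of the sphere to a basis
  if their form value is neither 1 nor -1.\<close>

definition frame :: "complex ^ 3 \<Rightarrow> complex ^ 3 \<Rightarrow> complex ^ 3 ^ 3" where
  "frame T U = vector [T, U,
     vector [T $ 2 * U $ 3 - T $ 3 * U $ 2, T $ 3 * U $ 1 - T $ 1 * U $ 3, T $ 1 * U $ 2 - T $ 2 * U $ 1]]"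

lemma frame_gram:
  assumes "T \<in> sphere2C" "U \<in> sphere2C" "bilin T U = c"
  shows "frame T U ** transpose (frame T U)
    = vector [vector [1, c, 0], vector [c, 1, 0], vector [0, 0, 1 - c\<^sup>2]]"
proof -
  have 1: "T $ 1 * T $ 1 + T $ 2 * T $ 2 + T $ 3 * T $ 3 = 1" "U $ 1 * U $ 1 + U $ 2 * U $ 2 + U $ 3 * U $ 3 = 1"
    and 2: "c = T $ 1 * U $ 1 + T $ 2 * U $ 2 + T $ 3 * U $ 3"
    using assms by (auto simp: sphere2C_iff bilin_3)
  \<comment> \<open>Lagrange's identity for the cross product.\<close>
  have 3: "(T $ 2 * U $ 3 - T $ 3 * U $ 2) * (T $ 2 * U $ 3 - T $ 3 * U $ 2)
      + (T $ 3 * U $ 1 - T $ 1 * U $ 3) * (T $ 3 * U $ 1 - T $ 1 * U $ 3)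
      + (T $ 1 * U $ 2 - T $ 2 * U $ 1) * (T $ 1 * U $ 2 - T $ 2 * U $ 1) = 1 - c\<^sup>2"
    using 1 unfolding 2 by algebra
  show ?thesis
    unfolding vec_eq_iff forall_3
    using 1 2 3 by (simp add: frame_def matrix_matrix_mult_def transpose_def sum_3) (simp add: algebra_simps)
qed

lemma det_frame:
  assumes "T \<in> sphere2C" "U \<in> sphere2C" "bilin T U = c"
  shows "det (frame T U) = 1 - c\<^sup>2"
proof -
  have 1: "T $ 1 * T $ 1 + T $ 2 * T $ 2 + T $ 3 * T $ 3 = 1" "U $ 1 * U $ 1 + U $ 2 * U $ 2 + U $ 3 * U $ 3 = 1"
    and 2: "c = T $ 1 * U $ 1 + T $ 2 * U $ 2 + T $ 3 * U $ 3"
    using assms by (auto simp: sphere2C_iff bilin_3)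
  show ?thesis
    unfolding 2 using 1 by (simp add: frame_def det_3) algebra
qed

lemma frame_rows: "frame T U $ 1 = T" "frame T U $ 2 = U"
  by (simp_all add: frame_def)

text \<open>Frames with the same \<open>c\<close> have equal Gram matrices and equal determinants,
  so the change of basis between them is orthogonal of determinant 1.\<close>

lemma SO3C_transitive_on_pairs:
  assumes TU: "T \<in> sphere2C" "U \<in> sphere2C" "bilin T U = c"
    and TU': "T' \<in> sphere2C" "U' \<in> sphere2C" "bilin T' U' = c"
    and c: "c\<^sup>2 \<noteq> 1"
  obtains \<sigma> where "\<sigma> \<in> SO3C" "\<sigma> *v T = T'" "\<sigma> *v U = U'"
proof -
  let ?C = "frame T U" and ?C' = "frame T' U'"
  have det: "det ?C = 1 - c\<^sup>2" "det ?C' = 1 - c\<^sup>2" using det_frame TU TU' by auto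
  then have "invertible ?C" using c by (simp add: invertible_det_nz)
  then obtain B where B: "?C ** B = mat 1" "B ** ?C = mat 1" by (auto simp: invertible_def)
  \<comment> \<open>Chosen so that \<open>?C ** transpose \<sigma> = ?C'\<close>, which says row by
    row that \<open>\<sigma>\<close> carries \<open>T\<close> to \<open>T'\<close> and
    \<open>U\<close> to \<open>U'\<close>.\<close>
  define \<sigma> where "\<sigma> = transpose (B ** ?C')"
  have gram: "?C' ** transpose ?C' = ?C ** transpose ?C"
    using frame_gram[OF TU] frame_gram[OF TU'] by simp
  have "transpose \<sigma> ** \<sigma> = (B ** ?C') ** (transpose ?C' ** transpose B)"
    by (simp add: \<sigma>_def matrix_transpose_mul)
  also have "\<dots> = B ** (?C' ** transpose ?C') ** transpose B"
    by (simp add: matrix_mul_assoc)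
  also have "\<dots> = (B ** ?C) ** transpose (B ** ?C)"
    by (simp add: gram matrix_mul_assoc matrix_transpose_mul)
  finally have orth: "transpose \<sigma> ** \<sigma> = mat 1" using B by simp
  then have orth': "\<sigma> ** transpose \<sigma> = mat 1" using matrix_left_right_inverse by blast
  have "det ?C * det B = 1" using B(1) by (metis det_I det_mul)
  then have "det \<sigma> = 1"
    using det by (simp add: \<sigma>_def det_mul mult.commute)
  then have SO: "\<sigma> \<in> SO3C" using orth orth' by (simp add: SO3C_def)
  have "?C ** transpose \<sigma> = ?C'" using B by (simp add: \<sigma>_def matrix_mul_assoc)
  then have row: "(\<sigma> *v (?C $ i)) = ?C' $ i" for i
    by (auto simp: vec_eq_iff matrix_matrix_mult_def matrix_vector_mult_def transpose_def mult.commute)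
  show thesis using that[OF SO] row[of 1] row[of 2] by (simp add: frame_rows)
qed

text \<open>A complex sum of two squares may vanish, but the three such sums add up to 2, so one is
  nonzero. Projecting to that coordinate plane, turning by a right angle and normalising gives
  \<open>U\<close>.\<close>

lemma sphere2C_orthogonal_exists:
  assumes "T \<in> sphere2C"
  obtains U where "U \<in> sphere2C" "bilin T U = 0"
proof -
  let ?x = "T $ 1" and ?y = "T $ 2" and ?z = "T $ 3"
  have 1: "?x\<^sup>2 + ?y\<^sup>2 + ?z\<^sup>2 = 1" using assms by (simp add: sphere2C_def)
  have norm: "(a / csqrt (a\<^sup>2 + b\<^sup>2))\<^sup>2 + (b / csqrt (a\<^sup>2 + b\<^sup>2))\<^sup>2 = 1"
    if "a\<^sup>2 + b\<^sup>2 \<noteq> 0" for a b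
    using that by (simp add: power_divide add_divide_distrib[symmetric])
  consider "?x\<^sup>2 + ?y\<^sup>2 \<noteq> 0" | "?x\<^sup>2 + ?z\<^sup>2 \<noteq> 0" | "?y\<^sup>2 + ?z\<^sup>2 \<noteq> 0"
  proof -
    have "(?x\<^sup>2 + ?y\<^sup>2) + (?x\<^sup>2 + ?z\<^sup>2) + (?y\<^sup>2 + ?z\<^sup>2) = 2" using 1 by (simp add: algebra_simps)
    then have "\<not> (?x\<^sup>2 + ?y\<^sup>2 = 0 \<and> ?x\<^sup>2 + ?z\<^sup>2 = 0 \<and> ?y\<^sup>2 + ?z\<^sup>2 = 0)"
      by (metis add.right_neutral zero_neq_numeral)
    then show thesis using that by blast
  qed
  then show thesis
  proof cases
    case 1
    let ?s = "csqrt (?x\<^sup>2 + ?y\<^sup>2)"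
    show thesis
      by (rule that[of "vector [- (?y / ?s), ?x / ?s, 0]"])
        (use norm[OF 1] in \<open>auto simp: sphere2C_def bilin_3 add.commute\<close>)
  next
    case 2
    let ?s = "csqrt (?x\<^sup>2 + ?z\<^sup>2)"
    show thesis
      by (rule that[of "vector [- (?z / ?s), 0, ?x / ?s]"])
        (use norm[OF 2] in \<open>auto simp: sphere2C_def bilin_3 add.commute\<close>)
  next
    case 3
    let ?s = "csqrt (?y\<^sup>2 + ?z\<^sup>2)"
    show thesis
      by (rule that[of "vector [0, - (?z / ?s), ?y / ?s]"])
        (use norm[OF 3] in \<open>auto simp: sphere2C_def bilin_3 add.commute\<close>)
  qed
qed

lemma SO3C_transitive:
  assumes "T \<in> sphere2C" "T' \<in> sphere2C"
  obtains \<sigma> where "\<sigma> \<in> SO3C" "\<sigma> *v T = T'"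
proof -
  obtain U U' where "U \<in> sphere2C" "bilin T U = 0" "U' \<in> sphere2C" "bilin T' U' = 0"
    using sphere2C_orthogonal_exists assms by metis
  then show thesis using SO3C_transitive_on_pairs[of T U 0 T' U'] assms that by auto
qed

subsection \<open>Flexible assignments from NAP-colorings\<close>

definition sph_point :: "real \<Rightarrow> real \<Rightarrow> complex ^ 3" where
  "sph_point a \<theta> = vector [of_real (sin a * cos \<theta>), of_real (sin a * sin \<theta>), of_real (cos a)]"

lemma bilin_sph_point:
  "bilin (sph_point a \<theta>) (sph_point b \<phi>) = of_real (sin a * sin b * cos (\<theta> - \<phi>) + cos a * cos b)"
  by (simp add: bilin_3 sph_point_def cos_diff algebra_simps)

lemma sph_point_sphere: "sph_point a \<theta> \<in> sphere2C"
proof -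
  have "sin a * sin a + cos a * cos a = 1"
    using sin_cos_squared_add[of a] by (simp add: power2_eq_square)
  then show ?thesis by (simp add: sphere2C_iff bilin_sph_point)
qed

lemma cos_not_unit:
  fixes d :: real
  assumes "0 < \<bar>d\<bar>" "\<bar>d\<bar> \<le> 1"
  shows "cos d \<noteq> 1" "cos d \<noteq> -1"
proof -
  have "\<bar>d\<bar> < pi" using assms pi_gt3 by linarith
  then have "sin \<bar>d\<bar> > 0" using assms by (intro sin_gt_zero) auto
  then have "(sin \<bar>d\<bar>)\<^sup>2 > 0" by simp
  then have "(cos d)\<^sup>2 \<noteq> 1" using sin_cos_squared_add[of "\<bar>d\<bar>"] by auto
  then show "cos d \<noteq> 1" "cos d \<noteq> -1" by auto
qed

text \<open>Vertices meeting both colors are never adjacent, so they can all be put at the north pole. The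
  other vertices meeting a red edge rotate about the axis, and the rest stays fixed.\<close>

lemma NAP_imp_flexible:
  assumes G: "simple_graph V E" and NAP: "NAP_coloring E \<epsilon>"
  shows "\<exists>lam. flexible_assignment V E lam"
proof -
  define red where "red v \<longleftrightarrow> (\<exists>x. {v, x} \<in> E \<and> \<epsilon> {v, x} = Red)" for v
  define blue where "blue v \<longleftrightarrow> (\<exists>x. {v, x} \<in> E \<and> \<epsilon> {v, x} = Blue)" for v
  have noalt: "\<not> alternating_path E \<epsilon> v w z t" for v w z t
    using NAP by (auto simp: NAP_coloring_def)
  have not_both: "\<not> (red a \<and> blue a \<and> red b \<and> blue b)" if "{a, b} \<in> E" for a b
  proof
    \<comment> \<open>Whatever the color of \<open>{a, b}\<close>, both ends have an edge of the
      other color, and the three edges form an alternating path.\<close>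
    assume *: "red a \<and> blue a \<and> red b \<and> blue b"
    then obtain x y x' y' where "{a, x} \<in> E" "\<epsilon> {a, x} = Red" "{a, y} \<in> E" "\<epsilon> {a, y} = Blue"
      "{b, x'} \<in> E" "\<epsilon> {b, x'} = Red" "{b, y'} \<in> E" "\<epsilon> {b, y'} = Blue"
      by (auto simp: red_def blue_def)
    then show False
      using noalt[of x a b x'] noalt[of y a b y'] that
      by (cases "\<epsilon> {a, b}") (auto simp: alternating_path_def insert_commute)
  qed
  have finV: "finite V" using G by (simp add: simple_graph_def)
  have EV: "a \<in> V \<and> b \<in> V \<and> a \<noteq> b" if "{a, b} \<in> E" for a b
    using G that unfolding simple_graph_def by (force simp: doubleton_eq_iff)
  obtain f :: "'a \<Rightarrow> nat" where f: "inj_on f V"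
    using finite_imp_inj_to_nat_seg[OF finV] by blast
  \<comment> \<open>Polar angles: 0 at the pole, and distinct values in (0, 1] elsewhere since
    \<open>f\<close> is injective. So adjacent vertices, never both at the pole, have different
    angles.\<close>
  define \<alpha> where "\<alpha> v = (if red v \<and> blue v then 0 else 1 / (1 + real (f v)))" for v
  define pos where "pos \<theta> v = sph_point (\<alpha> v) (if red v then \<theta> else 0)" for \<theta> v
  have \<alpha>_range: "0 \<le> \<alpha> v" "\<alpha> v \<le> 1" for v by (auto simp: \<alpha>_def field_simps)
  have \<alpha>_pos: "0 < \<alpha> v" if "\<not> (red v \<and> blue v)" for v using that by (auto simp: \<alpha>_def field_simps)
  have \<alpha>_ne: "\<alpha> a \<noteq> \<alpha> b" if "{a, b} \<in> E" for a b
  proof (cases "red a \<and> blue a \<or> red b \<and> blue b")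
    case True
    then show ?thesis using not_both[OF that] \<alpha>_pos[of a] \<alpha>_pos[of b] by (auto simp: \<alpha>_def)
  next
    case False
    then show ?thesis using EV[OF that] f by (auto simp: \<alpha>_def inj_on_def)
  qed
  have edge: "bilin (pos \<theta> a) (pos \<theta> b) = of_real (cos (\<alpha> a - \<alpha> b))" if e: "{a, b} \<in> E" for \<theta> a b
  proof -
    \<comment> \<open>Rotation could only distort an edge between a vertex meeting red and one that
      does not. Such an edge is blue, so its moving end meets both colors and sits at the
      pole.\<close>
    have "\<alpha> a = 0 \<or> \<alpha> b = 0 \<or> red a = red b"
    proof (cases "\<epsilon> {a, b}")
      case Red
      then have "red a" "red b" using e by (auto simp: red_def) (metis insert_commute)
      then show ?thesis by simp
    next
      case Blue
      then have "blue a" "blue b" using e by (auto simp: blue_def) (metis insert_commute)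
      then show ?thesis by (auto simp: \<alpha>_def)
    qed
    then show ?thesis by (auto simp: pos_def bilin_sph_point cos_diff[of "\<alpha> a" "\<alpha> b"] add.commute)
  qed
  \<comment> \<open>An edge does not order its ends; the choice is harmless as the cosine is
    even.\<close>
  define lam where "lam e = (SOME d. \<exists>a b. e = {a, b} \<and> d = (1 - complex_of_real (cos (\<alpha> a - \<alpha> b))) / 2)" for e
  have lam: "lam {a, b} = (1 - of_real (cos (\<alpha> a - \<alpha> b))) / 2" for a b
    unfolding lam_def
  proof (rule some_equality)
    fix d assume "\<exists>x y. {a, b} = {x, y} \<and> d = (1 - complex_of_real (cos (\<alpha> x - \<alpha> y))) / 2"
    then show "d = (1 - of_real (cos (\<alpha> a - \<alpha> b))) / 2"
      by (auto simp: doubleton_eq_iff) (metis cos_minus minus_diff_eq)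
  qed blast
  have asg: "assignment E lam"
    unfolding assignment_def
  proof
    fix e assume "e \<in> E"
    then obtain a b where e: "e = {a, b}" "{a, b} \<in> E" using G by (auto simp: simple_graph_def)
    have ne: "cos (\<alpha> a - \<alpha> b) \<noteq> 1" "cos (\<alpha> a - \<alpha> b) \<noteq> -1"
      using cos_not_unit[of "\<alpha> a - \<alpha> b"] \<alpha>_ne[OF e(2)] \<alpha>_range[of a] \<alpha>_range[of b] by auto
    then have "complex_of_real (cos (\<alpha> a - \<alpha> b)) \<noteq> 1" "complex_of_real (cos (\<alpha> a - \<alpha> b)) \<noteq> -1"
      by (metis of_real_eq_1_iff, metis of_real_eq_iff of_real_1 of_real_minus)
    then show "lam e \<notin> {0, 1}" unfolding e(1) lam by (auto simp: field_simps eq_neg_iff_add_eq_0 add.commute)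
  qed
  have good: "realization V (pos \<theta>) \<and> compatible E lam (pos \<theta>)" for \<theta>
    using edge by (auto simp: realization_def compatible_def pos_def[abs_def] sph_point_sphere sph_dist_def lam)
  obtain r where r: "r \<in> V" "red r" "\<not> blue r"
  proof -
    obtain e where "e \<in> E" "\<epsilon> e = Red" using NAP by (auto simp: NAP_coloring_def) (metis UNIV_I imageE)
    then obtain a b where e: "{a, b} \<in> E" "\<epsilon> {a, b} = Red" using G by (auto simp: simple_graph_def)
    then have "red a" "red b" by (auto simp: red_def) (metis insert_commute)
    then show thesis using not_both[OF e(1)] EV[OF e(1)] that by blast
  qed
  obtain s where s: "s \<in> V" "blue s" "\<not> red s"
  proof -
    obtain e where "e \<in> E" "\<epsilon> e = Blue" using NAP by (auto simp: NAP_coloring_def) (metis UNIV_I imageE)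
    then obtain a b where e: "{a, b} \<in> E" "\<epsilon> {a, b} = Blue" using G by (auto simp: simple_graph_def)
    then have "blue a" "blue b" by (auto simp: blue_def) (metis insert_commute)
    then show thesis using not_both[OF e(1)] EV[OF e(1)] that by blast
  qed
  \<comment> \<open>This rotation invariant compares a moving vertex with a fixed one and determines
    \<open>\<theta>\<close> in \<open>{0..1}\<close>, where the cosine is injective.\<close>
  have bil: "bilin (pos \<theta> r) (pos \<theta> s) = of_real (sin (\<alpha> r) * sin (\<alpha> s) * cos \<theta> + cos (\<alpha> r) * cos (\<alpha> s))" for \<theta>
    using r s by (simp add: pos_def bilin_sph_point)
  have "sin (\<alpha> v) > 0" if "\<not> (red v \<and> blue v)" for v
    using \<alpha>_pos[OF that] \<alpha>_range(2)[of v] pi_gt3 by (intro sin_gt_zero) auto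
  then have sin_ne: "sin (\<alpha> r) * sin (\<alpha> s) \<noteq> 0" using r s by (metis less_irrefl mult_eq_0_iff)
  have same: "\<theta> = \<phi>" if "\<theta> \<in> {0..1}" "\<phi> \<in> {0..1}" "bilin (pos \<theta> r) (pos \<theta> s) = bilin (pos \<phi> r) (pos \<phi> s)" for \<theta> \<phi>
  proof -
    have "cos \<theta> = cos \<phi>" using that(3) sin_ne unfolding bil of_real_eq_iff by simp
    then show ?thesis using cos_inj_pi[of \<theta> \<phi>] that(1,2) pi_gt3 by simp
  qed
  then have "inj_on pos {0..1}" by (intro inj_onI same) auto
  then have inf: "infinite (pos ` {0..1})" by (simp add: finite_image_iff infinite_Icc)
  have "pairwise (essentially_distinct V) (pos ` {0..1})"
    unfolding pairwise_def essentially_distinct_def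
  proof (intro ballI impI notI)
    fix \<rho>\<^sub>1 \<rho>\<^sub>2 assume "\<rho>\<^sub>1 \<in> pos ` {0..1}" "\<rho>\<^sub>2 \<in> pos ` {0..1}" and ne: "\<rho>\<^sub>1 \<noteq> \<rho>\<^sub>2"
      and "\<exists>\<sigma>\<in>SO3C. \<forall>v\<in>V. \<rho>\<^sub>1 v = \<sigma> *v \<rho>\<^sub>2 v"
    then obtain \<theta> \<phi> \<sigma> where *: "\<theta> \<in> {0..1}" "\<phi> \<in> {0..1}" "\<rho>\<^sub>1 = pos \<theta>" "\<rho>\<^sub>2 = pos \<phi>"
      "\<sigma> \<in> SO3C" "\<forall>v\<in>V. pos \<theta> v = \<sigma> *v pos \<phi> v" by blast
    then have "bilin (pos \<theta> r) (pos \<theta> s) = bilin (pos \<phi> r) (pos \<phi> s)"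
      using r s by (simp add: SO3C_bilin)
    then show False using same[of \<theta> \<phi>] * ne by blast
  qed
  then show ?thesis unfolding flexible_assignment_def using asg inf good by blast
qed

subsection \<open>NAP-colorings from flexible assignments\<close>

definition iso_u :: "complex ^ 3 \<Rightarrow> complex" where "iso_u T = T $ 1 + \<i> * T $ 2"
definition iso_w :: "complex ^ 3 \<Rightarrow> complex" where "iso_w T = T $ 1 - \<i> * T $ 2"

lemma bilin_iso: "2 * bilin T U = 2 * (T $ 3 * U $ 3) + iso_u T * iso_w U + iso_w T * iso_u U"
  by (simp add: bilin_3 iso_u_def iso_w_def algebra_simps)

lemma sphere2C_iso: "T \<in> sphere2C \<longleftrightarrow> iso_u T * iso_w T + T $ 3 * T $ 3 = 1"
  by (simp add: sphere2C_iff bilin_3 iso_u_def iso_w_def algebra_simps)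

lemma iso_eqI:
  assumes "iso_u T = iso_u U" "iso_w T = iso_w U" "T $ 3 = U $ 3"
  shows "T = U"
proof -
  have 1: "X $ 1 = (iso_u X + iso_w X) / 2" and 2: "X $ 2 = (iso_u X - iso_w X) / (2 * \<i>)" for X
    by (simp_all add: iso_u_def iso_w_def)
  have "T $ 1 = U $ 1" "T $ 2 = U $ 2"
    using assms unfolding 1[of T] 1[of U] 2[of T] 2[of U] by simp_all
  then show ?thesis using assms by (simp add: vec_eq_iff forall_3)
qed

lemma zero_or_unit:
  fixes f :: "nat \<Rightarrow> complex"
  assumes "\<And>n m. f n = 0 \<longleftrightarrow> f m = 0"
  shows "f = 0 \<or> f dvd 1"
proof (cases "f 0 = 0")
  case True
  then have "f = 0" using assms[of _ 0] by (auto simp: fun_eq_iff)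
  then show ?thesis ..
next
  case False
  then have "f n \<noteq> 0" for n using assms[of n 0] by auto
  then have "1 = f * (\<lambda>n. 1 / f n)" by (auto simp: fun_eq_iff)
  then show ?thesis by (metis dvdI)
qed

text \<open>The middle edge of a red-blue-red path has a low end, which is also an end of a red edge whose other
  end is hi; a blue-red-blue path is impossible since red edges have a hi end and blue ones do not.\<close>

lemma NAP_from_marking:
  assumes hl: "\<And>a b. {a, b} \<in> E \<Longrightarrow> hi a \<Longrightarrow> \<not> low b"
    and cover: "\<And>a b. {a, b} \<in> E \<Longrightarrow> hi a \<or> hi b \<or> low a \<or> low b"
    and red: "{w, s} \<in> E" "hi s" and blue: "{v, w} \<in> E" "\<not> hi v" "\<not> hi w"
  shows "\<exists>\<epsilon>. NAP_coloring E \<epsilon>"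
proof -
  define \<epsilon> where "\<epsilon> e = (if \<exists>x\<in>e. hi x then Red else Blue)" for e
  have "\<epsilon> {w, s} = Red" "\<epsilon> {v, w} = Blue" using red blue by (auto simp: \<epsilon>_def)
  then have "x \<in> \<epsilon> ` E" for x using red(1) blue(1) by (cases x) (auto intro: rev_image_eqI)
  then have "\<epsilon> ` E = UNIV" by blast
  moreover have "\<not> alternating_path E \<epsilon> a b c d" for a b c d
  proof
    assume *: "alternating_path E \<epsilon> a b c d"
    then have E: "{a, b} \<in> E" "{b, c} \<in> E" "{c, d} \<in> E" by (auto simp: alternating_path_def)
    then show False
      using * cover[OF E(2)] hl[OF E(1)] hl[OF E(3)] hl[of d c]
      by (auto simp: alternating_path_def \<epsilon>_def insert_commute split: if_splits)
  qed
  ultimately show ?thesis unfolding NAP_coloring_def by blast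
qed

text \<open>The sequence is read as one realization over the ring of sequences, where constant zero
  patterns make each coordinate 0 or a unit.\<close>

lemma degenerating_sequence_NAP:
  fixes \<rho> :: "nat \<Rightarrow> 'v \<Rightarrow> complex ^ 3"
  assumes EV: "\<And>a b. {a, b} \<in> E \<Longrightarrow> a \<in> V \<and> b \<in> V"
    and real: "\<And>n. realization V (\<rho> n)"
    and edge: "\<And>n a b. {a, b} \<in> E \<Longrightarrow> bilin (\<rho> n a) (\<rho> n b) = c {a, b}"
    and c: "\<And>e. e \<in> E \<Longrightarrow> (c e)\<^sup>2 \<noteq> 1"
    and path: "{v, w} \<in> E" "{w, s} \<in> E"
    and \<rho>w: "\<And>n. \<rho> n w = vector [0, 0, 1]" and \<rho>v: "\<And>n. \<rho> n v = F"
    and inf: "infinite (range (\<lambda>n. iso_u (\<rho> n s)))"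
    and u0: "\<And>x n m. x \<in> V \<Longrightarrow> iso_u (\<rho> n x) = 0 \<longleftrightarrow> iso_u (\<rho> m x) = 0"
    and w0: "\<And>x n m. x \<in> V \<Longrightarrow> iso_w (\<rho> n x) = 0 \<longleftrightarrow> iso_w (\<rho> m x) = 0"
    and z0: "\<And>x n m. x \<in> V \<Longrightarrow> \<rho> n x $ 3 = 0 \<longleftrightarrow> \<rho> m x $ 3 = 0"
  shows "\<exists>\<epsilon>. NAP_coloring E \<epsilon>"
proof -
  define u where "u x = (\<lambda>n. iso_u (\<rho> n x))" for x
  define w' where "w' x = (\<lambda>n. iso_w (\<rho> n x))" for x
  define z where "z x = (\<lambda>n. \<rho> n x $ 3)" for x
  obtain A M where pp: "proper_pair A M" and val: "\<And>x y. x * y = 1 \<Longrightarrow> x \<in> A \<or> y \<in> M"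
    and const: "\<And>c. (\<lambda>_. c) \<in> A" and t: "u s \<in> M"
    using valuation_pair_on_sequences[OF inf] unfolding u_def by metis
  note D = proper_pairD[OF pp]
  have sph: "u x * w' x + z x * z x = 1" "w' x * u x + z x * z x = 1" if "x \<in> V" for x
    using real that by (auto simp: fun_eq_iff u_def w'_def z_def realization_def sphere2C_iso mult.commute)
  have edge': "2 * (\<lambda>_. c {a, b}) = 2 * (z a * z b) + u a * w' b + w' a * u b" if "{a, b} \<in> E" for a b
  proof
    fix n
    show "(2 * (\<lambda>_. c {a, b})) n = (2 * (z a * z b) + u a * w' b + w' a * u b) n"
      using bilin_iso[of "\<rho> n a" "\<rho> n b"] edge[OF that, of n]
      by (simp add: u_def w'_def z_def numeral_fun)
  qed
  define hi where "hi x \<longleftrightarrow> dominant M (w' x) (z x)" for x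
  define low where "low x \<longleftrightarrow> dominant A (u x) (z x)" for x
  have mid: "u x \<in> M \<and> z x \<in> A \<and> w' x \<in> A" if "x \<in> V" "\<not> hi x" "\<not> low x" for x
  proof (rule valuation_trichotomy[OF pp val sph(1)[OF that(1)]])
    show "u x = 0 \<or> u x dvd 1" unfolding u_def by (rule zero_or_unit) (rule u0[OF that(1)])
    show "w' x = 0 \<or> w' x dvd 1" unfolding w'_def by (rule zero_or_unit) (rule w0[OF that(1)])
    show "z x = 0 \<or> z x dvd 1" unfolding z_def by (rule zero_or_unit) (rule z0[OF that(1)])
  qed (use that in \<open>auto simp: hi_def low_def\<close>)
  \<comment> \<open>A constant coordinate lies in \<open>A\<close>, so an inverse in
    \<open>M\<close> would put 1 into \<open>M\<close>.\<close>
  have const_not_hi: "\<not> hi x" if "\<And>n. \<rho> n x = T" for x T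
  proof
    assume "hi x"
    then obtain j where "w' x * j = 1" "j \<in> M" by (auto simp: hi_def dominant_def)
    moreover have "w' x \<in> A" using const[of "iso_w T"] by (simp add: w'_def that)
    ultimately show False using D(14)[of "w' x" j] D(4) by simp
  qed
  \<comment> \<open>As \<open>w\<close> is the pole, the third coordinate of \<open>s\<close> is the
    constant \<open>?k\<close>. So the product of \<open>w' s\<close> and \<open>u s\<close> is a
    nonzero constant, and the inverse of \<open>w' s\<close> is a constant multiple of
    \<open>u s\<close>.\<close>
  have "hi s"
  proof -
    let ?k = "c {w, s}"
    have "s \<in> V" using EV path by blast
    have zs: "z s = (\<lambda>_. ?k)" using edge[OF path(2)] by (auto simp: z_def \<rho>w bilin_3 fun_eq_iff)
    have k: "1 - ?k\<^sup>2 \<noteq> 0" using c path by auto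
    have wu: "w' s n * u s n = 1 - ?k\<^sup>2" for n
      using fun_cong[OF sph(2)[OF \<open>s \<in> V\<close>], of n] zs by (simp add: power2_eq_square algebra_simps)
    have "w' s * ((\<lambda>_. 1 / (1 - ?k\<^sup>2)) * u s) = 1"
      using wu k by (auto simp: fun_eq_iff field_simps)
    moreover have "(\<lambda>_. 1 / (1 - ?k\<^sup>2)) * u s \<in> M" using D(14) const t by blast
    ultimately show ?thesis unfolding hi_def dominant_def using D(14) const zs by metis
  qed
  show ?thesis
  proof (rule NAP_from_marking[of E hi low])
    show "\<not> low b" if "{a, b} \<in> E" "hi a" for a b
      using hi_lo_not_adjacent[OF pp const sph(1) sph(1) edge'[OF that(1)]] EV[OF that(1)] that(2)
      unfolding hi_def low_def by blast
    show "hi a \<or> hi b \<or> low a \<or> low b" if e: "{a, b} \<in> E" for a b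
    proof (rule ccontr)
      assume *: "\<not> (hi a \<or> hi b \<or> low a \<or> low b)"
      have V: "a \<in> V" "b \<in> V" using EV[OF e] by auto
      let ?k = "c {a, b}"
      have k: "?k * ?k - 1 \<noteq> 0" using c[OF e] by (simp add: power2_eq_square)
      show False
      proof (rule mid_mid_not_adjacent[OF pp _ const const _ const sph(1)[OF V(1)] sph(1)[OF V(2)] edge'[OF e]])
        show "2 * (\<lambda>_. 1 / 2) = (1 :: nat \<Rightarrow> complex)" by (auto simp: fun_eq_iff numeral_fun)
        show "((\<lambda>_. ?k) * (\<lambda>_. ?k) - 1) * (\<lambda>_. 1 / (?k * ?k - 1)) = (1 :: nat \<Rightarrow> complex)"
          using k by (auto simp: fun_eq_iff)
      qed (use mid V * in auto)
    qed
    show "\<not> hi v" by (rule const_not_hi[OF \<rho>v])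
    show "\<not> hi w" by (rule const_not_hi[OF \<rho>w])
  qed (use path \<open>hi s\<close> in auto)
qed

section \<open>Normalising an edge and extracting a degenerating sequence\<close>

text \<open>A connected graph without edges has at most one vertex, and rotations act transitively
  on the sphere, so no two realizations are essentially distinct.\<close>

lemma flexible_imp_edge:
  assumes conn: "connected_graph V E" and flex: "flexible_assignment V E lam"
  shows "E \<noteq> {}"
proof
  assume E: "E = {}"
  obtain R where R: "infinite R" "\<And>\<rho>. \<rho> \<in> R \<Longrightarrow> realization V \<rho>"
    "pairwise (essentially_distinct V) R"
    using flex by (auto simp: flexible_assignment_def)
  obtain \<rho>\<^sub>1 where 1: "\<rho>\<^sub>1 \<in> R" using R(1) by fastforce
  have "R - {\<rho>\<^sub>1} \<noteq> {}" using R(1) by (intro infinite_imp_nonempty) simp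
  then obtain \<rho>\<^sub>2 where 2: "\<rho>\<^sub>2 \<in> R" "\<rho>\<^sub>1 \<noteq> \<rho>\<^sub>2" by blast
  have ed: "essentially_distinct V \<rho>\<^sub>1 \<rho>\<^sub>2" using R(3) 1 2 by (auto simp: pairwise_def)
  have one: "a = b" if "a \<in> V" "b \<in> V" for a b
    using conn that E by (auto simp: connected_graph_def)
  show False
  proof (cases "V = {}")
    case True
    have "(mat 1 :: complex ^ 3 ^ 3) \<in> SO3C" by (simp add: SO3C_def transpose_mat)
    then show ?thesis using ed True by (auto simp: essentially_distinct_def)
  next
    case False
    then obtain a where a: "a \<in> V" by blast
    then have "\<rho>\<^sub>2 a \<in> sphere2C" "\<rho>\<^sub>1 a \<in> sphere2C" using R(2) 1 2 by (auto simp: realization_def)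
    then obtain \<sigma> where "\<sigma> \<in> SO3C" "\<sigma> *v \<rho>\<^sub>2 a = \<rho>\<^sub>1 a" by (rule SO3C_transitive)
    then show ?thesis using ed one[OF a] unfolding essentially_distinct_def by metis
  qed
qed

text \<open>A reference partner of the pole, common to all edges with form value
  \<open>c\<close>.\<close>

definition tilted :: "complex \<Rightarrow> complex ^ 3" where
  "tilted c = vector [csqrt (1 - c\<^sup>2), 0, c]"

lemma rotate_edge_to_pole:
  assumes "T \<in> sphere2C" "U \<in> sphere2C" "bilin T U = c" "c\<^sup>2 \<noteq> 1"
  obtains \<sigma> where "\<sigma> \<in> SO3C" "\<sigma> *v T = vector [0, 0, 1]" "\<sigma> *v U = tilted c"
proof (rule SO3C_transitive_on_pairs[OF assms(1-3) _ _ _ assms(4)])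
  show "vector [0, 0, 1] \<in> sphere2C" "tilted c \<in> sphere2C" "bilin (vector [0, 0, 1]) (tilted c) = c"
    by (simp_all add: sphere2C_def tilted_def bilin_3)
qed (use that in blast)

lemma flexible_imp_NAP:
  fixes V :: "'v set"
  assumes G: "simple_graph V E" and conn: "connected_graph V E" and flex: "flexible_assignment V E lam"
  shows "\<exists>\<epsilon>. NAP_coloring E \<epsilon>"
proof -
  have finV: "finite V" using G by (simp add: simple_graph_def)
  have EV: "a \<in> V \<and> b \<in> V" if "{a, b} \<in> E" for a b
    using G that unfolding simple_graph_def by (force simp: doubleton_eq_iff)
  obtain R where R: "infinite R" "\<And>\<rho>. \<rho> \<in> R \<Longrightarrow> realization V \<rho>"
    "\<And>\<rho>. \<rho> \<in> R \<Longrightarrow> compatible E lam \<rho>" "pairwise (essentially_distinct V) R"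
    using flex unfolding flexible_assignment_def by blast
  \<comment> \<open>The form value prescribed by \<open>lam\<close>; excluding 0 and 1 there
    excludes 1 and -1 here.\<close>
  define c where "c e = 1 - 2 * lam e" for e
  have c: "(c e)\<^sup>2 \<noteq> 1" if "e \<in> E" for e
    using flex that by (auto simp: flexible_assignment_def assignment_def c_def power2_eq_1_iff)
  have edge: "bilin (\<rho> a) (\<rho> b) = c {a, b}" if "\<rho> \<in> R" "{a, b} \<in> E" for \<rho> a b
    using R(3)[OF that(1)] that(2) by (auto simp: compatible_def c_def sph_dist_def field_simps)
  obtain e where "e \<in> E" using flexible_imp_edge[OF conn flex] by blast
  then obtain a b where ab: "{a, b} \<in> E" using G unfolding simple_graph_def by metis
  have "\<exists>\<sigma>. \<sigma> \<in> SO3C \<and> \<sigma> *v \<rho> a = vector [0, 0, 1] \<and> \<sigma> *v \<rho> b = tilted (c {a, b})" if "\<rho> \<in> R" for \<rho>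
    using rotate_edge_to_pole[of "\<rho> a" "\<rho> b" "c {a, b}"] R(2)[OF that] edge[OF that ab] EV[OF ab] c[OF ab]
    unfolding realization_def by metis
  then obtain S where S: "\<And>\<rho>. \<rho> \<in> R \<Longrightarrow> S \<rho> \<in> SO3C" "\<And>\<rho>. \<rho> \<in> R \<Longrightarrow> S \<rho> *v \<rho> a = vector [0, 0, 1]"
    "\<And>\<rho>. \<rho> \<in> R \<Longrightarrow> S \<rho> *v \<rho> b = tilted (c {a, b})"
    by metis
  \<comment> \<open>The value 0 outside \<open>V\<close> ensures that finitely many positions per
    vertex leave only finitely many functions.\<close>
  define nrm where "nrm \<rho> = (\<lambda>x. if x \<in> V then S \<rho> *v \<rho> x else 0)" for \<rho>
  define Q where "Q = nrm ` R"
  have "inj_on nrm R"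
  proof (rule inj_onI, rule ccontr)
    fix \<rho>\<^sub>1 \<rho>\<^sub>2 assume 12: "\<rho>\<^sub>1 \<in> R" "\<rho>\<^sub>2 \<in> R" "nrm \<rho>\<^sub>1 = nrm \<rho>\<^sub>2" "\<rho>\<^sub>1 \<noteq> \<rho>\<^sub>2"
    let ?\<tau> = "transpose (S \<rho>\<^sub>1) ** S \<rho>\<^sub>2"
    have "?\<tau> \<in> SO3C" using SO3C_mult SO3C_transpose S(1) 12 by blast
    moreover have "\<rho>\<^sub>1 x = ?\<tau> *v \<rho>\<^sub>2 x" if "x \<in> V" for x
    proof -
      have "S \<rho>\<^sub>1 *v \<rho>\<^sub>1 x = S \<rho>\<^sub>2 *v \<rho>\<^sub>2 x"
        using fun_cong[OF 12(3), of x] that by (simp add: nrm_def)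
      then have "transpose (S \<rho>\<^sub>1) *v (S \<rho>\<^sub>1 *v \<rho>\<^sub>1 x) = ?\<tau> *v \<rho>\<^sub>2 x"
        by (simp add: matrix_vector_mul_assoc)
      then show ?thesis using S(1)[OF 12(1)] by (simp add: matrix_vector_mul_assoc SO3C_def)
    qed
    ultimately show False using R(4) 12 unfolding pairwise_def essentially_distinct_def by blast
  qed
  then have Qinf: "infinite Q" using R(1) by (simp add: Q_def finite_image_iff)
  have Qsph: "\<rho> x \<in> sphere2C" if "\<rho> \<in> Q" "x \<in> V" for \<rho> x
    using that R(2) S(1) by (auto simp: Q_def nrm_def realization_def SO3C_sphere)
  have Qedge: "bilin (\<rho> x) (\<rho> y) = c {x, y}" if "\<rho> \<in> Q" "{x, y} \<in> E" for \<rho> x y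
    using that EV[OF that(2)] S(1) edge by (auto simp: Q_def nrm_def SO3C_bilin)
  define Fin where "Fin x \<longleftrightarrow> finite ((\<lambda>\<rho>. \<rho> x) ` Q)" for x
  have Fa: "Fin a"
  proof -
    have "(\<lambda>\<rho>. \<rho> a) ` Q \<subseteq> {vector [0, 0, 1]}" using S(2) EV[OF ab] by (auto simp: Q_def nrm_def)
    then show ?thesis unfolding Fin_def by (rule finite_subset) simp
  qed
  have Fb: "Fin b"
  proof -
    have "(\<lambda>\<rho>. \<rho> b) ` Q \<subseteq> {tilted (c {a, b})}" using S(3) EV[OF ab] by (auto simp: Q_def nrm_def)
    then show ?thesis unfolding Fin_def by (rule finite_subset) simp
  qed
  obtain s\<^sub>0 where s0: "s\<^sub>0 \<in> V" "\<not> Fin s\<^sub>0"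
  proof (rule ccontr)
    assume "\<not> thesis"
    then have "finite (\<Union>x\<in>V. (\<lambda>\<rho>. \<rho> x) ` Q)" using that finV by (auto simp: Fin_def)
    then have "finite {f. \<forall>x. (x \<in> V \<longrightarrow> f x \<in> (\<Union>x\<in>V. (\<lambda>\<rho>. \<rho> x) ` Q)) \<and> (x \<notin> V \<longrightarrow> f x = 0)}"
      by (rule finite_set_of_finite_funs[OF finV])
    moreover have "Q \<subseteq> {f. \<forall>x. (x \<in> V \<longrightarrow> f x \<in> (\<Union>x\<in>V. (\<lambda>\<rho>. \<rho> x) ` Q)) \<and> (x \<notin> V \<longrightarrow> f x = 0)}"
    proof (intro subsetI CollectI allI conjI impI)
      show "\<rho> x \<in> (\<Union>x\<in>V. (\<lambda>\<rho>. \<rho> x) ` Q)" if "\<rho> \<in> Q" "x \<in> V" for \<rho> x using that by blast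
      show "\<rho> x = 0" if "\<rho> \<in> Q" "x \<notin> V" for \<rho> x using that by (auto simp: Q_def nrm_def)
    qed
    ultimately show False using Qinf finite_subset by blast
  qed
  \<comment> \<open>Walk from \<open>a\<close> towards \<open>s\<^sub>0\<close>, up to the first vertex with infinitely many positions.\<close>
  define P where "P x \<longleftrightarrow> Fin x \<and> (\<exists>y. {y, x} \<in> E \<and> Fin y)" for x
  have "P a" using Fa Fb ab by (auto simp: P_def insert_commute)
  have "\<exists>x y. {x, y} \<in> E \<and> P x \<and> \<not> P y"
  proof (rule ccontr)
    assume no: "\<not> ?thesis"
    have "(a, s\<^sub>0) \<in> {(u, v). {u, v} \<in> E}\<^sup>*" using conn s0 EV[OF ab] by (auto simp: connected_graph_def)
    then have "P s\<^sub>0"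
      by (induction rule: rtrancl_induct) (use \<open>P a\<close> no in auto)
    then show False using s0 by (simp add: P_def)
  qed
  then obtain w s where ws: "{w, s} \<in> E" "P w" "\<not> P s" by blast
  \<comment> \<open>\<open>w\<close> is a neighbor of \<open>s\<close> with finitely many positions,
    so \<open>P\<close> can fail at \<open>s\<close> only because \<open>s\<close> has infinitely
    many.\<close>
  then obtain v where vw: "{v, w} \<in> E" "Fin v" "Fin w" "\<not> Fin s" by (auto simp: P_def)
  have V: "v \<in> V" "w \<in> V" "s \<in> V" using EV ws vw by blast+
  \<comment> \<open>Keeping one realization for each position of \<open>s\<close> ensures that
    \<open>s\<close> still takes infinitely many positions after the pigeonhole principle has fixed
    \<open>w\<close> and \<open>v\<close>.\<close>
  obtain Q1 where Q1: "Q1 \<subseteq> Q" "inj_on (\<lambda>\<rho>. \<rho> s) Q1" "(\<lambda>\<rho>. \<rho> s) ` Q = (\<lambda>\<rho>. \<rho> s) ` Q1"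
    using subset_image_inj[of "(\<lambda>\<rho>. \<rho> s) ` Q" "\<lambda>\<rho>. \<rho> s" Q] by auto
  have "infinite Q1" using vw(4) Q1(3) by (auto simp: Fin_def)
  moreover have "finite ((\<lambda>\<rho>. (\<rho> w, \<rho> v)) ` Q1)"
  proof (rule finite_subset)
    show "(\<lambda>\<rho>. (\<rho> w, \<rho> v)) ` Q1 \<subseteq> (\<lambda>\<rho>. \<rho> w) ` Q \<times> (\<lambda>\<rho>. \<rho> v) ` Q" using Q1(1) by auto
    show "finite ((\<lambda>\<rho>. \<rho> w) ` Q \<times> (\<lambda>\<rho>. \<rho> v) ` Q)" using vw by (simp add: Fin_def)
  qed
  ultimately obtain \<rho>\<^sub>0 where \<rho>0: "\<rho>\<^sub>0 \<in> Q1" "infinite {\<rho>\<in>Q1. (\<rho> w, \<rho> v) = (\<rho>\<^sub>0 w, \<rho>\<^sub>0 v)}"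
    using pigeonhole_infinite[of Q1 "\<lambda>\<rho>. (\<rho> w, \<rho> v)"] by blast
  define Q2 where "Q2 = {\<rho>\<in>Q1. (\<rho> w, \<rho> v) = (\<rho>\<^sub>0 w, \<rho>\<^sub>0 v)}"
  have \<rho>0Q: "\<rho>\<^sub>0 \<in> Q" using \<rho>0 Q1 by blast
  have wv: "{w, v} \<in> E" using vw by (simp add: insert_commute)
  \<comment> \<open>One rotation serves all of \<open>Q2\<close>, since \<open>w\<close> and
    \<open>v\<close> no longer move.\<close>
  obtain \<sigma> where \<sigma>: "\<sigma> \<in> SO3C" "\<sigma> *v \<rho>\<^sub>0 w = vector [0, 0, 1]" "\<sigma> *v \<rho>\<^sub>0 v = tilted (c {w, v})"
    using rotate_edge_to_pole[OF Qsph[OF \<rho>0Q V(2)] Qsph[OF \<rho>0Q V(1)] Qedge[OF \<rho>0Q wv] c[OF wv]] .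
  \<comment> \<open>A sequence of complex numbers is 0 or a unit in the ring of sequences only if its zeros do not
    depend on the index, hence the passage to a constant zero pattern.\<close>
  define pat where "pat \<rho> = ({x\<in>V. iso_u (\<sigma> *v \<rho> x) = 0}, {x\<in>V. iso_w (\<sigma> *v \<rho> x) = 0},
      {x\<in>V. (\<sigma> *v \<rho> x) $ 3 = 0})" for \<rho> :: "'v \<Rightarrow> complex ^ 3"
  have "finite (pat ` Q2)"
  proof (rule finite_subset)
    show "pat ` Q2 \<subseteq> Pow V \<times> Pow V \<times> Pow V" by (auto simp: pat_def)
    show "finite (Pow V \<times> Pow V \<times> Pow V)" using finV by simp
  qed
  then obtain \<rho>\<^sub>1 where \<rho>1: "infinite {\<rho>\<in>Q2. pat \<rho> = pat \<rho>\<^sub>1}"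
    using pigeonhole_infinite[of Q2 pat] \<rho>0(2) unfolding Q2_def by blast
  then obtain f :: "nat \<Rightarrow> 'v \<Rightarrow> complex ^ 3" where f: "inj f" "range f \<subseteq> {\<rho>\<in>Q2. pat \<rho> = pat \<rho>\<^sub>1}"
    using infinite_countable_subset by blast
  have fQ2: "f n \<in> Q2" and fpat: "pat (f n) = pat \<rho>\<^sub>1" for n using f(2) by auto
  have fQ1: "f n \<in> Q1" and fQ: "f n \<in> Q" for n using fQ2[of n] Q1(1) by (auto simp: Q2_def)
  have fwv: "f n w = \<rho>\<^sub>0 w" "f n v = \<rho>\<^sub>0 v" for n using fQ2[of n] by (auto simp: Q2_def)
  have patD: "iso_u (\<sigma> *v f n x) = 0 \<longleftrightarrow> iso_u (\<sigma> *v f m x) = 0"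
    "iso_w (\<sigma> *v f n x) = 0 \<longleftrightarrow> iso_w (\<sigma> *v f m x) = 0"
    "(\<sigma> *v f n x) $ 3 = 0 \<longleftrightarrow> (\<sigma> *v f m x) $ 3 = 0" if "x \<in> V" for n m x
  proof -
    have "pat (f n) = pat (f m)" using fpat by simp
    then show "iso_u (\<sigma> *v f n x) = 0 \<longleftrightarrow> iso_u (\<sigma> *v f m x) = 0"
      "iso_w (\<sigma> *v f n x) = 0 \<longleftrightarrow> iso_w (\<sigma> *v f m x) = 0"
      "(\<sigma> *v f n x) $ 3 = 0 \<longleftrightarrow> (\<sigma> *v f m x) $ 3 = 0"
      using that unfolding pat_def prod.inject by blast+
  qed
  have fedge: "bilin (\<sigma> *v f n x) (\<sigma> *v f n y) = c {x, y}" if "{x, y} \<in> E" for n x y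
    using Qedge[OF fQ that] by (simp add: SO3C_bilin[OF \<sigma>(1)])
  have fsph: "\<sigma> *v f n x \<in> sphere2C" if "x \<in> V" for n x
    using Qsph[OF fQ that] SO3C_sphere[OF \<sigma>(1)] by simp
  have z: "(\<sigma> *v f n s) $ 3 = c {w, s}" for n
    using fedge[OF ws(1), of n] by (simp add: fwv \<sigma> bilin_3)
  \<comment> \<open>At \<open>s\<close> the product of \<open>iso_u\<close> and \<open>iso_w\<close>
    is a nonzero constant, so \<open>iso_u\<close> determines the position of \<open>s\<close> and
    with it the realization.\<close>
  have "inj (\<lambda>n. iso_u (\<sigma> *v f n s))"
  proof (rule injI)
    fix n m assume u: "iso_u (\<sigma> *v f n s) = iso_u (\<sigma> *v f m s)"
    have uw: "iso_u (\<sigma> *v f k s) * iso_w (\<sigma> *v f k s) = 1 - (c {w, s})\<^sup>2" for k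
      using fsph[OF V(3), of k] by (simp add: sphere2C_iso z power2_eq_square algebra_simps)
    have "1 - (c {w, s})\<^sup>2 \<noteq> 0" using c[OF ws(1)] by simp
    then have "iso_w (\<sigma> *v f n s) = iso_w (\<sigma> *v f m s)"
      using uw[of n] uw[of m] u by (metis mult_cancel_left mult_zero_left)
    then have "\<sigma> *v f n s = \<sigma> *v f m s" using u z by (intro iso_eqI) auto
    then have "transpose \<sigma> *v (\<sigma> *v f n s) = transpose \<sigma> *v (\<sigma> *v f m s)" by simp
    then have "f n s = f m s" using \<sigma>(1) by (simp add: matrix_vector_mul_assoc SO3C_def)
    then have "f n = f m" using Q1(2) fQ1 by (auto simp: inj_on_def)
    then show "n = m" using f(1) by (simp add: inj_eq)
  qed
  then have inf: "infinite (range (\<lambda>n. iso_u (\<sigma> *v f n s)))" using finite_imageD by blast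
  show ?thesis
  proof (rule degenerating_sequence_NAP[where \<rho> = "\<lambda>n x. \<sigma> *v f n x" and V = V and c = c and v = v and w = w and s = s])
    show "realization V (\<lambda>x. \<sigma> *v f n x)" for n using fsph by (simp add: realization_def)
    show "\<sigma> *v f n w = vector [0, 0, 1]" for n by (simp add: fwv \<sigma>)
    show "\<sigma> *v f n v = tilted (c {w, v})" for n by (simp add: fwv \<sigma>)
  qed (fact EV fedge c vw(1) ws(1) inf patD)+
qed

theorem theorem3p14:
  fixes V :: "'v set" and E :: "'v set set"
  assumes "simple_graph V E" and "connected_graph V E"
  shows "(\<exists>lam. flexible_assignment V E lam) \<longleftrightarrow> (\<exists>\<epsilon>. NAP_coloring E \<epsilon>)"
  using NAP_imp_flexible flexible_imp_NAP assms by blast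

end
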